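(* Let $k$ be a field of characteristic zero and let $A$ be an associative unital $k$-algebra. Let $G(A)$ be the set of characters and $g(A)$ the set of infinitesimal characters on $\overline T(T(A))$. There is a bijection between $G(A)$ and $g(A)$ given as follows: for every $\Phi\in G(A)$ there exists a unique $\kappa\in g(A)$ such that $$\Phi=e+\kappa\prec\Phi=\exp^{\prec}(\kappa),$$ and conversely, for every $\kappa\in g(A)$, $\Phi:=\exp^{\prec}(\kappa)$ is a character.
   Context: **The bialgebra.** $T(A):=\bigoplus_{n>0}A^{\otimes n}$, with elements written as words $a_1\cdots a_n$. $T(T(A)):=\bigoplus_{n>0}T(A)^{\otimes n}$ and $\overline T(T(A)):=\bigoplus_{n\ge0}T(A)^{\otimes n}=T(T(A))\oplus k\mathbf 1$, with elements written with bars $w_1|\cdots|w_n$ ($w_i\in T(A)$); the product $a|b$ is bar-concatenation, with unit $\mathbf 1$. For a word $a_1\cdots a_n$ and $S=\{s_1<\cdots<s_p\}\subseteq[n]=\{1,\dots,n\}$, put $a_S:=a_{s_1}\cdots a_{s_p}$, $a_\emptyset:=\mathbf 1$. Let $J_1,\dots,J_r$ be the maximal runs of consecutive integers in $[n]-S$, in increasing order; put $a_{J^S_{[n]}}:=a_{J_1}|\cdots|a_{J_r}$ (equal to $\mathbf 1$ if $S=[n]$). The coproduct is $\Delta(a_1\cdots a_n):=\sum_{S\subseteq[n]}a_S\otimes a_{J^S_{[n]}}$, extended by $\Delta(w_1|\cdots|w_m):=\Delta(w_1)\cdots\Delta(w_m)$, $\Delta(\mathbf 1)=\mathbf 1\otimes\mathbf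 1$. **Left half-coproduct.** $\Delta^+_\prec(a_1\cdots a_n):=\sum_{1\in S\subseteq[n]}a_S\otimes a_{J^S_{[n]}}$, $\Delta^+_\prec(w_1|\cdots|w_m):=\Delta^+_\prec(w_1)\Delta(w_2)\cdots\Delta(w_m)$, and $\Delta_\prec(a):=\Delta^+_\prec(a)-a\otimes\mathbf 1$ for $a\in T(T(A))$. **Half-convolution.** Let $\mathcal L_A:=\mathrm{Lin}(T(T(A)),k)$ and $\overline{\mathcal L_A}:=\mathrm{Lin}(\overline T(T(A)),k)\cong\mathcal L_A\oplus k\,e$, where $e$ is the augmentation map (identity on $T(A)^{\otimes0}\cong k$, zero on $T(T(A))$), and $\mathcal L_A$ is identified with the linear forms vanishing on $\mathbf 1$. For $f,g\in\mathcal L_A$, $f\prec g:=m_k\circ(f\otimes g)\circ\Delta_\prec$, where $m_k$ is the product of $k$; moreover $f\prec e:=f$ and $e\prec f:=0$ for $f\in\mathcal L_A$. (Thus for $f\in\mathcal L_A$ and $g\in\overline{\mathcal L_A}$ with $g(\mathbf 1)=1$, $f\prec g$ vanishes on $\mathbf 1$ and equals $m_k\circ(f\otimes g)\circ\Delta^+_\prec$ on $T(T(A))$.) **Time-ordered exponential.** For $\kappa\in\mathcal L_A$: $\kappa^{\prec0}:=e$, $\kappa^{\prec n}:=\kappa\prec\kappa^{\prec(n-1)}$, and $\exp^\prec(\kappa):=e+\sum_{n>0}\kappa^{\prec n}$ (a finite sum when evaluated on any given element). **Characters.** $\Phi\in\overline{\mathcal L_A}$ is a character if $\Phi(\mathbf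 1)=1$ and $\Phi(a|b)=\Phi(a)\Phi(b)$ for all $a,b\in\overline T(T(A))$. $\kappa\in\overline{\mathcal L_A}$ is an infinitesimal character if $\kappa(\mathbf 1)=0$ and $\kappa(a|b)=0$ for all $a,b\in T(T(A))$. *)

theory Defs
  imports
    Complex_Main
    "HOL-Library.Poly_Mapping"
    "HOL-Library.Set_Algebras"
    "HOL-Library.FuncSet"
begin

text \<open>
  The type \<open>'x \<Rightarrow>\<^sub>0 'k\<close> of finitely supported functions is the free vector space on \<open>'x\<close>.
  Tensor constructions are quotients \<open>F/N\<close>, where \<open>F\<close> is the free space on some subset \<open>B\<close> of
  \<open>'x\<close> and \<open>N \<subseteq> F\<close> is a subspace of relations. Elements of \<open>F/N\<close> are cosets \<open>p +o N\<close>; their sum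
  is the elementwise sum \<open>X + Y\<close> of sets, and the zero vector is \<open>N\<close>.
\<close>

definition fscale :: "'k::field \<Rightarrow> ('x \<Rightarrow>\<^sub>0 'k) \<Rightarrow> ('x \<Rightarrow>\<^sub>0 'k)"
  where "fscale c p = Poly_Mapping.map ((*) c) p"

definition gen :: "'x \<Rightarrow> ('x \<Rightarrow>\<^sub>0 'k::field)"
  where "gen x = Poly_Mapping.single x 1"

definition quot :: "'x set \<Rightarrow> ('x \<Rightarrow>\<^sub>0 'k::field) set \<Rightarrow> ('x \<Rightarrow>\<^sub>0 'k) set set"
  where "quot B N = {p +o N | p. Poly_Mapping.keys p \<subseteq> B}"

text \<open>Adding \<open>N\<close> makes the result a full coset also for \<open>c = 0\<close>.\<close>

definition qscale :: "('x \<Rightarrow>\<^sub>0 'k::field) set \<Rightarrow> 'k \<Rightarrow> ('x \<Rightarrow>\<^sub>0 'k) set \<Rightarrow> ('x \<Rightarrow>\<^sub>0 'k) set"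
  where "qscale N c X = fscale c ` X + N"

text \<open>
  The next three definitions are the maps induced on quotients by values on generators.
  They are evaluated on all representatives of a coset at once; they are used only where the
  value does not depend on the representative.

  \<open>qlift N' g\<close> is the linear map into a quotient modulo \<open>N'\<close> sending the class of each generator
  \<open>x\<close> to the coset \<open>g x\<close>; \<open>klift g\<close> is the analogous scalar-valued map; \<open>qlift2 N m\<close> is the
  bilinear product sending the classes of \<open>x\<close> and \<open>y\<close> to the class of \<open>m x y\<close>.
\<close>

definition qlift ::
  "('y \<Rightarrow>\<^sub>0 'k::field) set \<Rightarrow> ('x \<Rightarrow> ('y \<Rightarrow>\<^sub>0 'k) set) \<Rightarrow> ('x \<Rightarrow>\<^sub>0 'k) set \<Rightarrow> ('y \<Rightarrow>\<^sub>0 'k) set"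
  where "qlift N' g X =
    (\<Union>p\<in>X. (\<Sum>x\<in>Poly_Mapping.keys p. qscale N' (Poly_Mapping.lookup p x) (g x)) + N')"

definition klift :: "('x \<Rightarrow> 'k::field) \<Rightarrow> ('x \<Rightarrow>\<^sub>0 'k) set \<Rightarrow> 'k"
  where "klift g X =
    the_elem ((\<lambda>p. \<Sum>x\<in>Poly_Mapping.keys p. Poly_Mapping.lookup p x * g x) ` X)"

definition qlift2 ::
  "('x \<Rightarrow>\<^sub>0 'k::field) set \<Rightarrow> ('x \<Rightarrow> 'x \<Rightarrow> 'x) \<Rightarrow>
    ('x \<Rightarrow>\<^sub>0 'k) set \<Rightarrow> ('x \<Rightarrow>\<^sub>0 'k) set \<Rightarrow> ('x \<Rightarrow>\<^sub>0 'k) set"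
  where "qlift2 N m X Y =
    (\<Union>p\<in>X. \<Union>q\<in>Y.
      (\<Sum>x\<in>Poly_Mapping.keys p. \<Sum>y\<in>Poly_Mapping.keys q.
        fscale (Poly_Mapping.lookup p x * Poly_Mapping.lookup q y) (gen (m x y))) +o N)"

text \<open>
  Relations for the tensor algebra of a vector space with carrier \<open>V\<close>, addition \<open>+\<close> and scalar
  multiplication \<open>sc\<close>. The relations are homogeneous in the length of words, so the free space on
  \<open>lists V\<close> modulo these relations is the direct sum over \<open>n \<ge> 0\<close> of the \<open>n\<close>-fold tensor powers
  of \<open>V\<close>, a list being the tensor product of its entries; restricting to nonempty lists gives
  the direct sum over \<open>n > 0\<close>.
\<close>

definition tensor_alg_rel ::
  "'v::plus set \<Rightarrow> ('k::field \<Rightarrow> 'v \<Rightarrow> 'v) \<Rightarrow> ('v list \<Rightarrow>\<^sub>0 'k) set"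
  where "tensor_alg_rel V sc = module.span fscale
    ({gen (us @ [x + y] @ ws) - gen (us @ [x] @ ws) - gen (us @ [y] @ ws) | us ws x y.
        us \<in> lists V \<and> ws \<in> lists V \<and> x \<in> V \<and> y \<in> V} \<union>
     {gen (us @ [sc c x] @ ws) - fscale c (gen (us @ [x] @ ws)) | us ws c x.
        us \<in> lists V \<and> ws \<in> lists V \<and> x \<in> V})"

definition tensor_prod_rel ::
  "'v::plus set \<Rightarrow> ('k::field \<Rightarrow> 'v \<Rightarrow> 'v) \<Rightarrow> 'w::plus set \<Rightarrow> ('k \<Rightarrow> 'w \<Rightarrow> 'w) \<Rightarrow>
    ('v \<times> 'w \<Rightarrow>\<^sub>0 'k) set"
  where "tensor_prod_rel V sv W sw = module.span fscale
    ({gen (x + x', y) - gen (x, y) - gen (x', y) | x x' y. x \<in> V \<and> x' \<in> V \<and> y \<in> W} \<union>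
     {gen (x, y + y') - gen (x, y) - gen (x, y') | x y y'. x \<in> V \<and> y \<in> W \<and> y' \<in> W} \<union>
     {gen (sv c x, y) - fscale c (gen (x, y)) | c x y. x \<in> V \<and> y \<in> W} \<union>
     {gen (x, sw c y) - fscale c (gen (x, y)) | c x y. x \<in> V \<and> y \<in> W})"

text \<open>
  The maximal runs of consecutive integers in a finite set \<open>U\<close>, listed in increasing order: a
  maximal run is determined by its least element \<open>i\<close>, and the least elements are those \<open>i \<in> U\<close>
  that have no predecessor in \<open>U\<close>.
\<close>

definition runs :: "nat set \<Rightarrow> nat set list"
  where "runs U =
    map (\<lambda>i. {j. i \<le> j \<and> {i..j} \<subseteq> U}) (sorted_list_of_set {i\<in>U. i = 0 \<or> i - 1 \<notin> U})"

type_synonym ('k, 'a) tens = "('a list \<Rightarrow>\<^sub>0 'k) set"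
type_synonym ('k, 'a) tens2 = "(('k, 'a) tens list \<Rightarrow>\<^sub>0 'k) set"
type_synonym ('k, 'a) tens2_sq = "(('k, 'a) tens2 \<times> ('k, 'a) tens2 \<Rightarrow>\<^sub>0 'k) set"

context
  fixes s :: "'k::field \<Rightarrow> 'a::ab_group_add \<Rightarrow> 'a"
begin

text \<open>\<open>T(A)\<close>, with \<open>s\<close> the scalar multiplication of \<open>A\<close>.\<close>

definition TA_rel :: "('a list \<Rightarrow>\<^sub>0 'k) set"
  where "TA_rel = tensor_alg_rel UNIV s"

definition TA :: "('k, 'a) tens set"
  where "TA = quot (lists UNIV - {[]}) TA_rel"

definition word :: "'a list \<Rightarrow> ('k, 'a) tens"
  where "word a = gen a +o TA_rel"

text \<open>
  \<open>TTbar\<close> is the full tensor algebra of \<open>T(A)\<close> and \<open>TT\<close> its part of positive degree;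
  \<open>bars [w\<^sub>1, \<dots>, w\<^sub>m]\<close> is \<open>w\<^sub>1|\<dots>|w\<^sub>m\<close>.
\<close>

definition TT_rel :: "(('k, 'a) tens list \<Rightarrow>\<^sub>0 'k) set"
  where "TT_rel = tensor_alg_rel TA (qscale TA_rel)"

definition TTbar :: "('k, 'a) tens2 set"
  where "TTbar = quot (lists TA) TT_rel"

definition TT :: "('k, 'a) tens2 set"
  where "TT = quot (lists TA - {[]}) TT_rel"

definition bars :: "('k, 'a) tens list \<Rightarrow> ('k, 'a) tens2"
  where "bars ws = gen ws +o TT_rel"

definition one_TT :: "('k, 'a) tens2"
  where "one_TT = bars []"

definition bar_mult :: "('k, 'a) tens2 \<Rightarrow> ('k, 'a) tens2 \<Rightarrow> ('k, 'a) tens2"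
  where "bar_mult = qlift2 TT_rel (@)"

text \<open>The tensor square of \<open>TTbar\<close>, with its componentwise product.\<close>

definition sq_rel :: "(('k, 'a) tens2 \<times> ('k, 'a) tens2 \<Rightarrow>\<^sub>0 'k) set"
  where "sq_rel = tensor_prod_rel TTbar (qscale TT_rel) TTbar (qscale TT_rel)"

definition tensor :: "('k, 'a) tens2 \<Rightarrow> ('k, 'a) tens2 \<Rightarrow> ('k, 'a) tens2_sq"
  where "tensor X Y = gen (X, Y) +o sq_rel"

definition sq_mult :: "('k, 'a) tens2_sq \<Rightarrow> ('k, 'a) tens2_sq \<Rightarrow> ('k, 'a) tens2_sq"
  where "sq_mult = qlift2 sq_rel (\<lambda>(x, y) (x', y'). (bar_mult x x', bar_mult y y'))"

text \<open>
  Positions in a word of length \<open>n\<close> are numbered \<open>0, \<dots>, n - 1\<close> instead of \<open>1, \<dots>, n\<close>, so that the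
  condition on the first letter becomes \<open>0 \<in> S\<close>.
\<close>

definition subword :: "'a list \<Rightarrow> nat set \<Rightarrow> ('k, 'a) tens2"
  where "subword a S = (if S = {} then one_TT else bars [word (nths a S)])"

definition cowords :: "'a list \<Rightarrow> nat set \<Rightarrow> ('k, 'a) tens2"
  where "cowords a S = bars (map (\<lambda>J. word (nths a J)) (runs ({..<length a} - S)))"

definition coprod_TA :: "('k, 'a) tens \<Rightarrow> ('k, 'a) tens2_sq"
  where "coprod_TA =
    qlift sq_rel (\<lambda>a. \<Sum>S | S \<subseteq> {..<length a}. tensor (subword a S) (cowords a S))"

definition coprod_bars :: "('k, 'a) tens list \<Rightarrow> ('k, 'a) tens2_sq"
  where "coprod_bars ws = foldr sq_mult (map coprod_TA ws) (tensor one_TT one_TT)"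

definition left_coprod_TA :: "('k, 'a) tens \<Rightarrow> ('k, 'a) tens2_sq"
  where "left_coprod_TA =
    qlift sq_rel (\<lambda>a. \<Sum>S | S \<subseteq> {..<length a} \<and> 0 \<in> S. tensor (subword a S) (cowords a S))"

text \<open>
  \<open>left_coprod_plus\<close> and \<open>left_coprod\<close> are meant for elements of \<open>TT\<close> only, whose
  representatives involve nonempty lists.
\<close>

definition left_coprod_plus :: "('k, 'a) tens2 \<Rightarrow> ('k, 'a) tens2_sq"
  where "left_coprod_plus =
    qlift sq_rel (\<lambda>ws. sq_mult (left_coprod_TA (hd ws)) (coprod_bars (tl ws)))"

definition left_coprod :: "('k, 'a) tens2 \<Rightarrow> ('k, 'a) tens2_sq"
  where "left_coprod X = left_coprod_plus X + qscale sq_rel (-1) (tensor X one_TT)"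

text \<open>
  Linear forms on \<open>TTbar\<close>. They are required to be \<open>undefined\<close> outside \<open>TTbar\<close>, so that two of
  them are equal as functions iff they agree on \<open>TTbar\<close>.
\<close>

definition lin_forms :: "(('k, 'a) tens2 \<Rightarrow> 'k) set"
  where "lin_forms = {f \<in> extensional TTbar.
    (\<forall>X\<in>TTbar. \<forall>Y\<in>TTbar. f (X + Y) = f X + f Y) \<and>
    (\<forall>c. \<forall>X\<in>TTbar. f (qscale TT_rel c X) = c * f X)}"

definition aug :: "('k, 'a) tens2 \<Rightarrow> 'k"
  where "aug = restrict (klift (\<lambda>ws. if ws = [] then 1 else 0)) TTbar"

text \<open>The projection of \<open>TTbar\<close> onto \<open>TT\<close> along the line spanned by the unit.\<close>

definition pos_part :: "('k, 'a) tens2 \<Rightarrow> ('k, 'a) tens2"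
  where "pos_part X = (\<lambda>p. p - Poly_Mapping.single [] (Poly_Mapping.lookup p [])) ` X"

text \<open>The composite of \<open>f \<otimes> g\<close> with the multiplication of the base field.\<close>

definition pairing ::
  "(('k, 'a) tens2 \<Rightarrow> 'k) \<Rightarrow> (('k, 'a) tens2 \<Rightarrow> 'k) \<Rightarrow> ('k, 'a) tens2_sq \<Rightarrow> 'k"
  where "pairing f g = klift (\<lambda>(X, Y). f X * g Y)"

text \<open>
  \<open>half_conv0\<close> is the half-convolution of linear forms on \<open>TT\<close>, where a form on \<open>TT\<close> is identified
  with its extension to \<open>TTbar\<close> that vanishes on the unit. \<open>half_conv\<close> extends it bilinearly
  by \<open>f \<prec> e = f\<close> and \<open>e \<prec> f = 0\<close>, using the decomposition \<open>f = form_part f + f(1) e\<close>; the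
  value \<open>e \<prec> e = 0\<close> is a convention without significance.
\<close>

definition half_conv0 ::
  "(('k, 'a) tens2 \<Rightarrow> 'k) \<Rightarrow> (('k, 'a) tens2 \<Rightarrow> 'k) \<Rightarrow> ('k, 'a) tens2 \<Rightarrow> 'k"
  where "half_conv0 f g = (\<lambda>X\<in>TTbar. pairing f g (left_coprod (pos_part X)))"

definition form_part :: "(('k, 'a) tens2 \<Rightarrow> 'k) \<Rightarrow> ('k, 'a) tens2 \<Rightarrow> 'k"
  where "form_part f = (\<lambda>X\<in>TTbar. f X - f one_TT * aug X)"

definition half_conv ::
  "(('k, 'a) tens2 \<Rightarrow> 'k) \<Rightarrow> (('k, 'a) tens2 \<Rightarrow> 'k) \<Rightarrow> ('k, 'a) tens2 \<Rightarrow> 'k"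
  where "half_conv f g =
    (\<lambda>X\<in>TTbar. half_conv0 (form_part f) (form_part g) X + g one_TT * form_part f X)"

primrec half_pow :: "(('k, 'a) tens2 \<Rightarrow> 'k) \<Rightarrow> nat \<Rightarrow> ('k, 'a) tens2 \<Rightarrow> 'k"
  where
    "half_pow \<kappa> 0 = aug"
  | "half_pow \<kappa> (Suc n) = half_conv \<kappa> (half_pow \<kappa> n)"

text \<open>For \<open>\<kappa>\<close> vanishing on the unit, the index set of the sum is finite for every \<open>X\<close>.\<close>

definition half_exp :: "(('k, 'a) tens2 \<Rightarrow> 'k) \<Rightarrow> ('k, 'a) tens2 \<Rightarrow> 'k"
  where "half_exp \<kappa> =
    (\<lambda>X\<in>TTbar. aug X + (\<Sum>n | n > 0 \<and> half_pow \<kappa> n X \<noteq> 0. half_pow \<kappa> n X))"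

definition characters :: "(('k, 'a) tens2 \<Rightarrow> 'k) set"
  where "characters = {\<Phi> \<in> lin_forms. \<Phi> one_TT = 1 \<and>
    (\<forall>X\<in>TTbar. \<forall>Y\<in>TTbar. \<Phi> (bar_mult X Y) = \<Phi> X * \<Phi> Y)}"

definition inf_characters :: "(('k, 'a) tens2 \<Rightarrow> 'k) set"
  where "inf_characters = {\<kappa> \<in> lin_forms. \<kappa> one_TT = 0 \<and>
    (\<forall>X\<in>TT. \<forall>Y\<in>TT. \<kappa> (bar_mult X Y) = 0)}"

end

end

theory Submission
  imports Defs
begin

text \<open>
  Let \<open>\<kappa>\<close> be an infinitesimal character, \<open>a\<close> a word and \<open>w\<close> a bar product of words. In the
  half-coproduct of \<open>a|w\<close>, the left tensor factors are products that start with a subword of \<open>a\<close>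
  containing the first letter. As \<open>\<kappa>\<close> vanishes on products of elements of positive degree, it only
  sees those terms in which nothing is taken out of \<open>w\<close>. Hence, with \<open>S\<close> running through the sets of
  positions in \<open>a\<close> that contain the first one, and with \<open>J\<^sub>1, \<dots>, J\<^sub>r\<close> the maximal runs of the complement
  of \<open>S\<close>,
  \<open>(\<kappa> \<prec> \<Phi>)(a|w) = \<Sum>\<^sub>S \<kappa>(a\<^sub>S) \<Phi>(a\<^bsub>J\<^sub>1\<^esub>|\<dots>|a\<^bsub>J\<^sub>r\<^esub>|w)\<close>,
  which is \<open>half_conv_Cons\<close>. The arguments of \<open>\<Phi>\<close> on the right have fewer letters than \<open>a|w\<close>, so
  \<open>\<Phi> = e + \<kappa> \<prec> \<Phi>\<close> is a recursion on the number of letters (\<open>left_recursion\<close>, \<open>fixed_point_iff\<close>).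

  Everything follows from this recursion. It has at most one solution \<open>\<Phi>\<close> for given \<open>\<kappa>\<close>
  (\<open>left_recursion_unique\<close>), and the time-ordered exponential is one (\<open>half_exp_left_recursion\<close>),
  since the \<open>n\<close>-th half-convolution power vanishes on arguments with fewer than \<open>n\<close> letters. The factor
  \<open>w\<close> is carried along unchanged, which makes the solution multiplicative
  (\<open>left_recursion_multiplicative\<close>). Conversely, if \<open>\<Phi>\<close> is a character, then on a single word \<open>a\<close> the
  full set of positions contributes \<open>\<kappa>(a)\<close>, whereas the other terms involve \<open>\<kappa>\<close> on shorter words only.
  So the recursion can be solved for \<open>\<kappa>\<close>, which yields both its uniqueness
  (\<open>left_recursion_determines\<close>) and its existence (\<open>cumulant\<close>, \<open>character_left_recursion\<close>); for the
  latter, the solution has to be multilinear in the letters (\<open>cumulant_multilinear\<close>).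

  The passage between functions on words and linear forms on the double tensor algebra relies on
  two facts: the bars of words span (\<open>TTbar_induct\<close>), and multilinear maps factor through tensor
  products (\<open>lext_tensor_alg_rel\<close>). The coproducts are accessed through their evaluation by pairs of
  linear forms (\<open>evaluates\<close>).
\<close>

section \<open>Free vector spaces and evaluation of sets of representatives\<close>

lemma lookup_fscale [simp]: "Poly_Mapping.lookup (fscale c p) x = c * Poly_Mapping.lookup p x"
  by (auto simp: fscale_def Poly_Mapping.map.rep_eq when_def)

lemma keys_fscale: "Poly_Mapping.keys (fscale c p) \<subseteq> Poly_Mapping.keys p"
  by (auto simp: in_keys_iff)

lemma keys_gen [simp]: "Poly_Mapping.keys (gen x :: 'x \<Rightarrow>\<^sub>0 'k::field) = {x}"
  by (simp add: gen_def)

definition supported_in :: "'x set \<Rightarrow> ('x \<Rightarrow>\<^sub>0 'k::field) set"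
  where "supported_in B = {p. Poly_Mapping.keys p \<subseteq> B}"

lemma gen_supported [simp]: "gen x \<in> supported_in B \<longleftrightarrow> x \<in> B"
  by (simp add: supported_in_def)

definition lin_ext :: "('k::field \<Rightarrow> 'v::ab_group_add \<Rightarrow> 'v) \<Rightarrow> ('x \<Rightarrow> 'v) \<Rightarrow> ('x \<Rightarrow>\<^sub>0 'k) \<Rightarrow> 'v"
  where "lin_ext sc g p =
    (\<Sum>x\<in>Poly_Mapping.keys p. sc (Poly_Mapping.lookup p x) (g x))"

context vector_space
begin

lemma lin_ext_superset:
  assumes "finite A" "Poly_Mapping.keys p \<subseteq> A"
  shows "lin_ext scale g p = (\<Sum>x\<in>A. scale (Poly_Mapping.lookup p x) (g x))"
  unfolding lin_ext_def
  by (rule sum.mono_neutral_left) (use assms in \<open>auto simp: in_keys_iff\<close>)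

lemma lin_ext_add: "lin_ext scale g (p + q) = lin_ext scale g p + lin_ext scale g q"
proof -
  let ?A = "Poly_Mapping.keys p \<union> Poly_Mapping.keys q"
  have "lin_ext scale g (p + q) = (\<Sum>x\<in>?A. scale (Poly_Mapping.lookup (p + q) x) (g x))"
    by (rule lin_ext_superset) (use keys_add[of p q] in auto)
  also have "\<dots> = lin_ext scale g p + lin_ext scale g q"
    by (simp add: lin_ext_superset[of ?A] lookup_add scale_left_distrib sum.distrib)
  finally show ?thesis .
qed

lemma lin_ext_scale: "lin_ext scale g (fscale c p) = scale c (lin_ext scale g p)"
  using lin_ext_superset[OF finite_keys keys_fscale]
  by (simp add: lin_ext_def scale_sum_right)

lemma lin_ext_zero [simp]: "lin_ext scale g 0 = 0"
  by (simp add: lin_ext_def)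

lemma lin_ext_diff: "lin_ext scale g (p - q) = lin_ext scale g p - lin_ext scale g q"
  using lin_ext_add[of g "p - q" q] by simp

lemma lin_ext_gen [simp]: "lin_ext scale g (gen x) = g x"
  by (simp add: lin_ext_def) (simp add: gen_def)

lemma lin_ext_fun_add:
  "lin_ext scale (\<lambda>x. g x + h x) p = lin_ext scale g p + lin_ext scale h p"
  by (simp add: lin_ext_def scale_right_distrib sum.distrib)

lemma lin_ext_fun_scale: "lin_ext scale (\<lambda>x. scale c (g x)) p = scale c (lin_ext scale g p)"
  by (simp add: lin_ext_def scale_sum_right mult.commute)

lemma lin_ext_sum:
  "lin_ext scale g (sum u A) = (\<Sum>i\<in>A. lin_ext scale g (u i))"
  by (induction A rule: infinite_finite_induct) (auto simp: lin_ext_add)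

lemma lin_ext_in_subspace:
  assumes "subspace M" "\<And>x. x \<in> Poly_Mapping.keys p \<Longrightarrow> g x \<in> M"
  shows "lin_ext scale g p \<in> M"
  unfolding lin_ext_def using assms by (intro subspace_sum subspace_scale) auto

end

interpretation free: vector_space "fscale :: 'k::field \<Rightarrow> ('x \<Rightarrow>\<^sub>0 'k) \<Rightarrow> ('x \<Rightarrow>\<^sub>0 'k)"
  by unfold_locales (auto intro!: poly_mapping_eqI simp: lookup_add algebra_simps)

abbreviation lext :: "('x \<Rightarrow> 'k::field) \<Rightarrow> ('x \<Rightarrow>\<^sub>0 'k) \<Rightarrow> 'k"
  where "lext \<equiv> lin_ext (*)"

lemma vector_space_scalars: "vector_space ((*) :: 'k::field \<Rightarrow> 'k \<Rightarrow> 'k)"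
  by unfold_locales (auto simp: algebra_simps)

lemmas lext_simps =
  vector_space.lin_ext_add[OF vector_space_scalars] vector_space.lin_ext_diff[OF vector_space_scalars]
  vector_space.lin_ext_scale[OF vector_space_scalars] vector_space.lin_ext_gen[OF vector_space_scalars]
  vector_space.lin_ext_zero[OF vector_space_scalars]

lemmas lext_fun_simps =
  vector_space.lin_ext_fun_add[OF vector_space_scalars]
  vector_space.lin_ext_fun_scale[OF vector_space_scalars]

lemma subspace_supported_in: "free.subspace (supported_in B)"
  unfolding free.subspace_def supported_in_def
  using keys_add keys_fscale by fastforce

lemma lin_ext_cong:
  "(\<And>x. x \<in> Poly_Mapping.keys p \<Longrightarrow> g x = h x) \<Longrightarrow> lin_ext sc g p = lin_ext sc h p"
  by (simp add: lin_ext_def)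

lemma lin_ext_gen_eq: "lin_ext fscale gen p = p"
  by (rule poly_mapping_eqI)
    (auto simp: lin_ext_def lookup_sum gen_def lookup_single when_def in_keys_iff
      if_distrib[where f = "(*) _"] cong: if_cong)

lemma free_induct [consumes 1, case_names zero gen add scale]:
  assumes "p \<in> supported_in B"
    and "P 0" and "\<And>x. x \<in> B \<Longrightarrow> P (gen x)"
    and "\<And>p q. p \<in> supported_in B \<Longrightarrow> q \<in> supported_in B \<Longrightarrow> P p \<Longrightarrow> P q \<Longrightarrow> P (p + q)"
    and "\<And>c p. p \<in> supported_in B \<Longrightarrow> P p \<Longrightarrow> P (fscale c p)"
  shows "P p"
proof -
  let ?M = "{p \<in> supported_in B. P p}"
  have "free.subspace ?M"
    using assms(2,4,5) subspace_supported_in[of B] by (auto simp: free.subspace_def)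
  moreover have "gen x \<in> ?M" if "x \<in> Poly_Mapping.keys p" for x
    using that assms(1,3) by (auto simp: supported_in_def)
  ultimately have "lin_ext fscale gen p \<in> ?M"
    by (rule free.lin_ext_in_subspace)
  then show ?thesis by (simp add: lin_ext_gen_eq)
qed

text \<open>
  A scalar-valued map on a quotient is applied to all representatives of a class at once. The
  following predicate expresses that the linear extension of \<open>g\<close> takes one and the same value on all
  of them. It is stable under the operations on sets of representatives from which the coproducts are
  built. Coproducts can therefore be evaluated against pairs of linear forms, where scalar
  multilinearity is all that has to be checked, instead of as elements of the tensor square.
\<close>

definition evaluates :: "('x \<Rightarrow> 'k::field) \<Rightarrow> ('x \<Rightarrow>\<^sub>0 'k) set \<Rightarrow> 'k \<Rightarrow> bool"
  where "evaluates g U v \<longleftrightarrow> U \<noteq> {} \<and> (\<forall>p\<in>U. lext g p = v)"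

lemma evaluatesD: "evaluates g U v \<Longrightarrow> p \<in> U \<Longrightarrow> lext g p = v"
  by (simp add: evaluates_def)

lemma klift_eqI: "evaluates g U v \<Longrightarrow> klift g U = v"
  unfolding klift_def evaluates_def lin_ext_def
  by (rule the_elem_image_unique) auto

lemma evaluates_coset:
  assumes "0 \<in> N" "\<And>r. r \<in> N \<Longrightarrow> lext g r = 0"
  shows "evaluates g (p +o N) (lext g p)"
  using assms by (auto simp: evaluates_def elt_set_plus_def lext_simps)

lemma evaluates_plus: "evaluates g U v \<Longrightarrow> evaluates g V w \<Longrightarrow> evaluates g (U + V) (v + w)"
  unfolding evaluates_def set_plus_def by (auto simp: lext_simps; blast)

lemma evaluates_qscale:
  assumes "evaluates g U v" "0 \<in> N" "\<And>r. r \<in> N \<Longrightarrow> lext g r = 0"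
  shows "evaluates g (qscale N c U) (c * v)"
  using assms unfolding evaluates_def qscale_def set_plus_def by (auto simp: lext_simps; blast)

lemma evaluates_sum:
  assumes "\<And>i. i \<in> A \<Longrightarrow> evaluates g (U i) (v i)"
  shows "evaluates g (sum U A) (sum v A)"
  using assms
proof (induction A rule: infinite_finite_induct)
  case (insert i A)
  then show ?case by (simp add: evaluates_plus)
qed (auto simp: evaluates_def lext_simps)

text \<open>
  Extending linearly commutes with evaluating: the values of \<open>g\<close> on the images of the generators
  form a scalar function \<open>val\<close>, and constancy of its extension on \<open>X\<close> is all that is required of
  \<open>X\<close>.
\<close>
lemma evaluates_qlift:
  assumes "evaluates val X v"
    and "\<And>p x. p \<in> X \<Longrightarrow> x \<in> Poly_Mapping.keys p \<Longrightarrow> evaluates g (G x) (val x)"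
    and N: "0 \<in> N" "\<And>r. r \<in> N \<Longrightarrow> lext g r = 0"
  shows "evaluates g (qlift N G X) v"
proof -
  let ?S = "\<lambda>p. (\<Sum>x\<in>Poly_Mapping.keys p. qscale N (Poly_Mapping.lookup p x) (G x)) + N"
  have "evaluates g (?S p) v" if "p \<in> X" for p
  proof -
    have "evaluates g (?S p) (lext val p + 0)"
      unfolding lin_ext_def
      by (intro evaluates_plus evaluates_sum evaluates_qscale assms(2)[OF that] N)
        (use N in \<open>auto simp: evaluates_def\<close>)
    then show ?thesis using evaluatesD[OF assms(1) that] by simp
  qed
  moreover have "X \<noteq> {}" using assms(1) by (simp add: evaluates_def)
  ultimately show ?thesis unfolding qlift_def evaluates_def by blast
qed

context
  fixes M :: "('x \<Rightarrow>\<^sub>0 'k::field) set"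
  assumes M: "free.subspace M"
begin

lemma plus_subset_subspace: "U \<subseteq> M \<Longrightarrow> V \<subseteq> M \<Longrightarrow> U + V \<subseteq> M"
  using M by (auto simp: set_plus_def free.subspace_def)

lemma qscale_subset_subspace: "N \<subseteq> M \<Longrightarrow> U \<subseteq> M \<Longrightarrow> qscale N c U \<subseteq> M"
  unfolding qscale_def using M by (intro plus_subset_subspace) (auto simp: free.subspace_def)

lemma sum_subset_subspace: "(\<And>i. i \<in> A \<Longrightarrow> U i \<subseteq> M) \<Longrightarrow> sum U A \<subseteq> M"
proof (induction A rule: infinite_finite_induct)
  case (insert i A)
  then show ?case by (simp add: plus_subset_subspace)
qed (use M in \<open>auto simp: free.subspace_def\<close>)

lemma coset_subset_subspace: "N \<subseteq> M \<Longrightarrow> p \<in> M \<Longrightarrow> p +o N \<subseteq> M"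
  using M by (auto simp: elt_set_plus_def free.subspace_def)

lemma qlift_subset_subspace:
  assumes "N \<subseteq> M" "\<And>p x. p \<in> X \<Longrightarrow> x \<in> Poly_Mapping.keys p \<Longrightarrow> G x \<subseteq> M"
  shows "qlift N G X \<subseteq> M"
proof -
  have "(\<Sum>x\<in>Poly_Mapping.keys p. qscale N (Poly_Mapping.lookup p x) (G x)) + N \<subseteq> M"
    if "p \<in> X" for p
    using that assms by (intro plus_subset_subspace sum_subset_subspace qscale_subset_subspace) auto
  then show ?thesis unfolding qlift_def by blast
qed

end

section \<open>Quotients of free spaces\<close>

lemma quotI: "p \<in> supported_in B \<Longrightarrow> p +o N \<in> quot B N"
  by (auto simp: quot_def supported_in_def)

lemma quotE:
  assumes "X \<in> quot B N" obtains p where "p \<in> supported_in B" "X = p +o N"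
  using assms by (auto simp: quot_def supported_in_def)

context
  fixes N :: "('x \<Rightarrow>\<^sub>0 'k::field) set"
  assumes N: "free.subspace N"
begin

lemma subspace_plus_self: "N + N = N"
  using N by (force simp: set_plus_def free.subspace_def)

lemma coset_plus: "(p +o N) + (q +o N) = (p + q) +o N"
  by (simp add: set_plus_rearrange subspace_plus_self)

lemma coset_qscale: "qscale N c (p +o N) = fscale c p +o N"
proof -
  have "fscale c ` (p +o N) + N = fscale c p +o (fscale c ` N + N)"
    unfolding elt_set_plus_def set_plus_def
    by (auto simp: free.scale_right_distrib image_iff) (metis add.assoc)+
  also have "fscale c ` N + N = N"
    using N by (force simp: set_plus_def free.subspace_def)
  finally show ?thesis by (simp add: qscale_def)
qed

lemma coset_eqI: "p - q \<in> N \<Longrightarrow> p +o N = q +o N"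
proof -
  assume pq: "p - q \<in> N"
  have "q - p \<in> N" using free.subspace_neg[OF N pq] by simp
  then have "p + n \<in> q +o N" "q + n \<in> p +o N" if "n \<in> N" for n
    using that pq free.subspace_add[OF N]
    by (metis (no_types, lifting) add_diff_cancel_right' add.commute diff_add_eq set_minus_imp_plus)+
  then show ?thesis by (auto simp: elt_set_plus_def)
qed

lemma quot_plus: "X \<in> quot B N \<Longrightarrow> Y \<in> quot B N \<Longrightarrow> X + Y \<in> quot B N"
  using free.subspace_add[OF subspace_supported_in]
  by (auto elim!: quotE simp: coset_plus intro!: quotI)

lemma quot_qscale: "X \<in> quot B N \<Longrightarrow> qscale N c X \<in> quot B N"
  using free.subspace_scale[OF subspace_supported_in]
  by (auto elim!: quotE simp: coset_qscale intro!: quotI)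

lemma quot_induct [consumes 1, case_names zero gen add scale]:
  assumes "X \<in> quot B N"
    and "P N" and "\<And>x. x \<in> B \<Longrightarrow> P (gen x +o N)"
    and "\<And>X Y. X \<in> quot B N \<Longrightarrow> Y \<in> quot B N \<Longrightarrow> P X \<Longrightarrow> P Y \<Longrightarrow> P (X + Y)"
    and "\<And>c X. X \<in> quot B N \<Longrightarrow> P X \<Longrightarrow> P (qscale N c X)"
  shows "P X"
proof -
  from assms(1) obtain p where p: "p \<in> supported_in B" "X = p +o N" by (rule quotE)
  from p(1) have "P (p +o N)"
  proof (induction rule: free_induct)
    case zero then show ?case using assms(2) by simp
  next
    case (gen x) then show ?case by (rule assms(3))
  next
    case (add p q)
    then show ?case using assms(4)[of "p +o N" "q +o N"] by (simp add: quotI coset_plus)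
  next
    case (scale c p)
    then show ?case using assms(5)[of "p +o N" c] by (simp add: quotI coset_qscale)
  qed
  with p show ?thesis by simp
qed

text \<open>
  A product of generators descends to the quotient as soon as the relations form a two-sided
  ideal for it.
\<close>

lemma qlift2_coset:
  assumes NB: "N \<subseteq> supported_in B"
    and left: "\<And>y r. y \<in> B \<Longrightarrow> r \<in> N \<Longrightarrow> lin_ext fscale (\<lambda>x. gen (m x y)) r \<in> N"
    and right: "\<And>x r. x \<in> B \<Longrightarrow> r \<in> N \<Longrightarrow> lin_ext fscale (\<lambda>y. gen (m x y)) r \<in> N"
    and p: "p \<in> supported_in B" and q: "q \<in> supported_in B"
  shows "qlift2 N m (p +o N) (q +o N) =
    lin_ext fscale (\<lambda>x. lin_ext fscale (\<lambda>y. gen (m x y)) q) p +o N"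
proof -
  let ?M = "\<lambda>p q. lin_ext fscale (\<lambda>x. lin_ext fscale (\<lambda>y. gen (m x y)) q) p"
  have M_add1: "?M (p + p') q = ?M p q + ?M p' q" for p p' q
    by (simp add: free.lin_ext_add)
  have M_add2: "?M p (q + q') = ?M p q + ?M p q'" for p q q'
    by (simp add: free.lin_ext_add free.lin_ext_fun_add)
  have swap: "?M p q = lin_ext fscale (\<lambda>y. lin_ext fscale (\<lambda>x. gen (m x y)) p) q" for p q
    unfolding lin_ext_def free.scale_sum_right
    by (subst sum.swap) (simp add: mult.commute)
  have shift: "?M (p + r) (q + r') +o N = ?M p q +o N" if r: "r \<in> N" "r' \<in> N" for r r'
  proof (rule coset_eqI)
    have q': "q + r' \<in> supported_in B"
      using q r NB free.subspace_add[OF subspace_supported_in] by blast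
    have "?M r (q + r') \<in> N"
      unfolding swap using q' r left
      by (intro free.lin_ext_in_subspace[OF N left]) (auto simp: supported_in_def)
    moreover have "?M p r' \<in> N"
      using p r right by (intro free.lin_ext_in_subspace[OF N right]) (auto simp: supported_in_def)
    moreover have "?M (p + r) (q + r') - ?M p q = ?M r (q + r') + ?M p r'"
      by (simp only: M_add1 M_add2) simp
    ultimately show "?M (p + r) (q + r') - ?M p q \<in> N"
      using free.subspace_add[OF N] by simp
  qed
  have "(\<Sum>x\<in>Poly_Mapping.keys p'. \<Sum>y\<in>Poly_Mapping.keys q'.
      fscale (Poly_Mapping.lookup p' x * Poly_Mapping.lookup q' y) (gen (m x y))) +o N =
      ?M p q +o N" if "p' \<in> p +o N" "q' \<in> q +o N" for p' q'
  proof -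
    from that obtain r r' where r: "p' = p + r" "q' = q + r'" "r \<in> N" "r' \<in> N"
      by (auto simp: elt_set_plus_def)
    have "(\<Sum>x\<in>Poly_Mapping.keys p'. \<Sum>y\<in>Poly_Mapping.keys q'.
        fscale (Poly_Mapping.lookup p' x * Poly_Mapping.lookup q' y) (gen (m x y))) = ?M p' q'"
      by (simp add: lin_ext_def free.scale_sum_right)
    with r shift show ?thesis by simp
  qed
  moreover have "p +o N \<noteq> {}" "q +o N \<noteq> {}"
    using free.subspace_0[OF N] by (auto simp: elt_set_plus_def)
  ultimately show ?thesis
    unfolding qlift2_def by (intro SUP_eq_const) auto
qed

end

section \<open>Multilinear maps on tensor algebras\<close>

definition multilinear_on ::
  "'v::plus set \<Rightarrow> ('k::field \<Rightarrow> 'v \<Rightarrow> 'v) \<Rightarrow> ('v list \<Rightarrow> 'k) \<Rightarrow> bool"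
  where "multilinear_on V sc F \<longleftrightarrow>
    (\<forall>us\<in>lists V. \<forall>vs\<in>lists V. \<forall>x\<in>V.
      (\<forall>y\<in>V. F (us @ [x + y] @ vs) = F (us @ [x] @ vs) + F (us @ [y] @ vs)) \<and>
      (\<forall>c. F (us @ [sc c x] @ vs) = c * F (us @ [x] @ vs)))"

lemma multilinear_onI:
  assumes "\<And>us vs x y. us \<in> lists V \<Longrightarrow> vs \<in> lists V \<Longrightarrow> x \<in> V \<Longrightarrow> y \<in> V \<Longrightarrow>
      F (us @ [x + y] @ vs) = F (us @ [x] @ vs) + F (us @ [y] @ vs)"
    and "\<And>us vs x c. us \<in> lists V \<Longrightarrow> vs \<in> lists V \<Longrightarrow> x \<in> V \<Longrightarrow>
      F (us @ [sc c x] @ vs) = c * F (us @ [x] @ vs)"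
  shows "multilinear_on V sc F"
  using assms by (auto simp: multilinear_on_def)

lemma multilinear_onD:
  assumes "multilinear_on V sc F" "us \<in> lists V" "vs \<in> lists V" "x \<in> V"
  shows "y \<in> V \<Longrightarrow> F (us @ [x + y] @ vs) = F (us @ [x] @ vs) + F (us @ [y] @ vs)"
    and "F (us @ [sc c x] @ vs) = c * F (us @ [x] @ vs)"
  using assms unfolding multilinear_on_def by blast+

lemma subspace_tensor_alg_rel: "free.subspace (tensor_alg_rel V sc)"
  unfolding tensor_alg_rel_def by (rule free.subspace_span)

lemma tensor_alg_rel_induct [consumes 1, case_names subspace plus scale]:
  assumes "r \<in> tensor_alg_rel V sc" and "free.subspace M"
    and "\<And>us vs x y. us \<in> lists V \<Longrightarrow> vs \<in> lists V \<Longrightarrow> x \<in> V \<Longrightarrow> y \<in> V \<Longrightarrow>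
      gen (us @ [x + y] @ vs) - gen (us @ [x] @ vs) - gen (us @ [y] @ vs) \<in> M"
    and "\<And>us vs x c. us \<in> lists V \<Longrightarrow> vs \<in> lists V \<Longrightarrow> x \<in> V \<Longrightarrow>
      gen (us @ [sc c x] @ vs) - fscale c (gen (us @ [x] @ vs)) \<in> M"
  shows "r \<in> M"
proof -
  have "tensor_alg_rel V sc \<subseteq> M"
    unfolding tensor_alg_rel_def
    by (rule free.span_minimal[OF _ assms(2)]) (use assms(3,4) in blast)
  with assms(1) show ?thesis by blast
qed

text \<open>
  The universal property of the tensor algebra, for scalar-valued maps.
\<close>
lemma lext_tensor_alg_rel:
  assumes "multilinear_on V sc F" "r \<in> tensor_alg_rel V sc"
  shows "lext F r = 0"
proof -
  have "r \<in> {r. lext F r = 0}"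
    using assms(2)
  proof (induction rule: tensor_alg_rel_induct)
    case subspace show ?case by (auto simp: free.subspace_def lext_simps)
  next
    case (plus us vs x y)
    then show ?case using multilinear_onD(1)[OF assms(1), of us vs x y] by (simp add: lext_simps)
  next
    case (scale us vs x c)
    then show ?case using multilinear_onD(2)[OF assms(1), of us vs x c] by (simp add: lext_simps)
  qed
  then show ?thesis by simp
qed

lemma evaluates_multilinear:
  assumes "multilinear_on V sc F"
  shows "evaluates F (p +o tensor_alg_rel V sc) (lext F p)"
  using free.subspace_0[OF subspace_tensor_alg_rel] lext_tensor_alg_rel[OF assms]
  by (rule evaluates_coset)

lemma klift_multilinear:
  "multilinear_on V sc F \<Longrightarrow> klift F (p +o tensor_alg_rel V sc) = lext F p"
  by (intro klift_eqI evaluates_multilinear)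

lemma klift_multilinear_plus:
  assumes F: "multilinear_on V sc F"
    and "X \<in> quot B (tensor_alg_rel V sc)" "Y \<in> quot B (tensor_alg_rel V sc)"
  shows "klift F (X + Y) = klift F X + klift F Y"
  using assms(2,3)
  by (auto elim!: quotE simp: coset_plus[OF subspace_tensor_alg_rel] klift_multilinear[OF F]
      lext_simps)

lemma klift_multilinear_qscale:
  assumes F: "multilinear_on V sc F" and "X \<in> quot B (tensor_alg_rel V sc)"
  shows "klift F (qscale (tensor_alg_rel V sc) c X) = c * klift F X"
  using assms(2)
  by (auto elim!: quotE simp: coset_qscale[OF subspace_tensor_alg_rel] klift_multilinear[OF F]
      lext_simps)

lemma tensor_alg_rel_base:
  assumes "us \<in> lists V" "vs \<in> lists V" "x \<in> V"
  shows "y \<in> V \<Longrightarrow>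
      gen (us @ [x + y] @ vs) - gen (us @ [x] @ vs) - gen (us @ [y] @ vs) \<in> tensor_alg_rel V sc"
    and "gen (us @ [sc c x] @ vs) - fscale c (gen (us @ [x] @ vs)) \<in> tensor_alg_rel V sc"
  unfolding tensor_alg_rel_def by (rule free.span_base; use assms in blast)+

lemma gen_coset_plus:
  assumes "us \<in> lists V" "vs \<in> lists V" "x \<in> V" "y \<in> V"
  shows "gen (us @ [x + y] @ vs) +o tensor_alg_rel V sc =
    (gen (us @ [x] @ vs) +o tensor_alg_rel V sc) + (gen (us @ [y] @ vs) +o tensor_alg_rel V sc)"
  unfolding coset_plus[OF subspace_tensor_alg_rel]
  by (rule coset_eqI[OF subspace_tensor_alg_rel])
    (use tensor_alg_rel_base(1)[OF assms] in \<open>simp add: diff_diff_eq\<close>)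

lemma gen_coset_scale:
  assumes "us \<in> lists V" "vs \<in> lists V" "x \<in> V"
  shows "gen (us @ [sc c x] @ vs) +o tensor_alg_rel V sc =
    qscale (tensor_alg_rel V sc) c (gen (us @ [x] @ vs) +o tensor_alg_rel V sc)"
  unfolding coset_qscale[OF subspace_tensor_alg_rel]
  by (rule coset_eqI[OF subspace_tensor_alg_rel]) (rule tensor_alg_rel_base(2)[OF assms])

lemma tensor_alg_rel_supported:
  assumes "\<And>x y. x \<in> V \<Longrightarrow> y \<in> V \<Longrightarrow> x + y \<in> V" "\<And>c x. x \<in> V \<Longrightarrow> sc c x \<in> V"
  shows "tensor_alg_rel V sc \<subseteq> supported_in (lists V - {[]})"
proof
  fix r assume "r \<in> tensor_alg_rel V sc"
  then show "r \<in> supported_in (lists V - {[]})"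
    by (induction rule: tensor_alg_rel_induct)
      (auto intro!: subspace_supported_in free.subspace_diff free.subspace_scale simp: assms)
qed

text \<open>
  Concatenation is a product on the tensor algebra: the relations are stable under multiplication
  from both sides.
\<close>
lemma tensor_alg_rel_concat:
  assumes "r \<in> tensor_alg_rel V sc" "as \<in> lists V" "bs \<in> lists V"
  shows "lin_ext fscale (\<lambda>ws. gen (as @ ws @ bs)) r \<in> tensor_alg_rel V sc"
proof -
  let ?N = "tensor_alg_rel V sc"
  have "r \<in> {r. lin_ext fscale (\<lambda>ws. gen (as @ ws @ bs)) r \<in> ?N}"
    using assms(1)
  proof (induction rule: tensor_alg_rel_induct)
    case subspace
    show ?case using subspace_tensor_alg_rel[of V sc]
      by (auto simp: free.subspace_def free.lin_ext_add free.lin_ext_scale)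
  next
    case (plus us vs x y)
    then show ?case
      using tensor_alg_rel_base(1)[of "as @ us" V "vs @ bs" x y sc] assms
      by (simp add: free.lin_ext_diff)
  next
    case (scale us vs x c)
    then show ?case
      using tensor_alg_rel_base(2)[of "as @ us" V "vs @ bs" x sc c] assms
      by (simp add: free.lin_ext_diff free.lin_ext_scale)
  qed
  then show ?thesis by simp
qed

section \<open>Runs and blocks\<close>

abbreviation run_from :: "nat set \<Rightarrow> nat \<Rightarrow> nat set"
  where "run_from U m \<equiv> {j. m \<le> j \<and> {m..j} \<subseteq> U}"

abbreviation run_starts :: "nat set \<Rightarrow> nat set"
  where "run_starts U \<equiv> {i\<in>U. i = 0 \<or> i - 1 \<notin> U}"

text \<open>
  If a run starting at \<open>m < m'\<close> reached a point of the run starting at \<open>m'\<close>, it would contain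
  \<open>m' - 1\<close>, contrary to \<open>m'\<close> being a start.
\<close>
lemma run_unique:
  assumes "m \<in> run_starts U" "m' \<in> run_starts U" "i \<in> run_from U m" "i \<in> run_from U m'"
  shows "m = m'"
proof -
  have "\<not> m < m'" if "m \<in> run_starts U" "m' \<in> run_starts U" "i \<in> run_from U m" "i \<in> run_from U m'"
    for m m'
  proof
    assume "m < m'"
    then have "m' - 1 \<in> {m..i}" "m' \<noteq> 0" using that by auto
    then show False using that by blast
  qed
  from this[OF assms] this[OF assms(2,1,4,3)] show ?thesis by simp
qed

lemma run_exists:
  assumes "i \<in> U" obtains m where "m \<in> run_starts U" "i \<in> run_from U m"
proof -
  define m where "m = (LEAST m. m \<le> i \<and> {m..i} \<subseteq> U)"
  have m: "m \<le> i \<and> {m..i} \<subseteq> U"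
    unfolding m_def by (rule LeastI[of _ i]) (use assms in auto)
  have "m - 1 \<notin> U" if "m \<noteq> 0"
  proof
    assume "m - 1 \<in> U"
    have "{m - 1..i} \<subseteq> U"
    proof
      fix j assume "j \<in> {m - 1..i}"
      then have "j = m - 1 \<or> j \<in> {m..i}" by auto
      then show "j \<in> U" using m \<open>m - 1 \<in> U\<close> by blast
    qed
    then have "m \<le> m - 1" using m unfolding m_def by (intro Least_le) auto
    with that show False by simp
  qed
  moreover have "m \<in> {m..i}" using m by simp
  ultimately have "m \<in> run_starts U" "i \<in> run_from U m" using m by blast+
  then show ?thesis by (rule that)
qed

context
  fixes U :: "nat set"
  assumes U: "finite U"
begin

lemma set_runs: "set (runs U) = run_from U ` run_starts U"
  using U by (simp add: runs_def)

lemma in_runsD: "J \<in> set (runs U) \<Longrightarrow> J \<subseteq> U \<and> J \<noteq> {}"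
  unfolding set_runs by fastforce

lemma runs_eq_Nil_iff: "runs U = [] \<longleftrightarrow> U = {}"
proof -
  have "run_starts U \<noteq> {}" if "i \<in> U" for i
    using run_exists[OF that] by blast
  then have "run_starts U = {} \<longleftrightarrow> U = {}" by blast
  then show ?thesis using set_runs by (metis (lifting) image_is_empty set_empty)
qed

text \<open>
  Since no element occurs in two runs, a letter occurs in at most one block, which makes functions of
  the blocks multilinear in the letters.
\<close>
lemma runs_split:
  assumes "i \<in> U"
  obtains Js J Ks where "runs U = Js @ [J] @ Ks" "i \<in> J" "\<And>K. K \<in> set (Js @ Ks) \<Longrightarrow> i \<notin> K"
proof -
  from run_exists[OF assms] obtain m where m: "m \<in> run_starts U" "i \<in> run_from U m" .
  define L where "L = sorted_list_of_set (run_starts U)"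
  have L: "set L = run_starts U" "distinct L" using U by (simp_all add: L_def)
  with m(1) obtain ls ms where split: "L = ls @ m # ms" by (metis split_list)
  have "i \<notin> run_from U m'" if "m' \<in> set (ls @ ms)" for m'
  proof
    assume "i \<in> run_from U m'"
    moreover have "m' \<in> set L" using that unfolding split by auto
    then have "m' \<in> run_starts U" unfolding L(1) .
    ultimately have "m' = m" using m run_unique by blast
    then show False using that L(2) unfolding split by auto
  qed
  then have "i \<notin> K" if "K \<in> set (map (run_from U) ls @ map (run_from U) ms)" for K
    using that unfolding map_append[symmetric] set_map by blast
  moreover have "runs U = map (run_from U) ls @ [run_from U m] @ map (run_from U) ms"
    unfolding runs_def L_def[symmetric] split by simp
  ultimately show ?thesis using m(2) that by blast
qed

lemma sum_card_runs: "sum_list (map card (runs U)) \<le> card U"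
proof -
  have sub: "run_from U m \<subseteq> U" for m by fastforce
  have "sum_list (map card (runs U)) = (\<Sum>m\<in>run_starts U. card (run_from U m))"
    unfolding runs_def map_map
    by (subst sum_list_distinct_conv_sum_set) (use U in auto)
  also have "\<dots> = card (\<Union>m\<in>run_starts U. run_from U m)"
  proof (rule card_UN_disjoint[symmetric])
    show "finite (run_starts U)" using U by simp
    show "\<forall>m\<in>run_starts U. finite (run_from U m)"
      using finite_subset[OF sub U] by blast
    show "\<forall>m\<in>run_starts U. \<forall>m'\<in>run_starts U. m \<noteq> m' \<longrightarrow> run_from U m \<inter> run_from U m' = {}"
      using run_unique by blast
  qed
  also have "\<dots> \<le> card U" by (rule card_mono[OF U]) (use sub in blast)
  finally show ?thesis .
qed

end

lemma runs_lessThan: "n > 0 \<Longrightarrow> runs {..<n} = [{..<n}]"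
proof -
  assume n: "n > 0"
  have "run_starts {..<n} = {0}" using n by auto
  moreover have "run_from {..<n} 0 = {..<n}" by auto
  ultimately show ?thesis unfolding runs_def by simp
qed

text \<open>
  The entries of \<open>cowords\<close> as lists of letters, before passing to tensors, so that letters can be
  counted and modified.
\<close>

definition blocks :: "'a list \<Rightarrow> nat set \<Rightarrow> 'a list list"
  where "blocks a S = map (nths a) (runs ({..<length a} - S))"

lemma Nil_notin_blocks: "[] \<notin> set (blocks a S)"
proof
  assume "[] \<in> set (blocks a S)"
  then obtain J where J: "J \<in> set (runs ({..<length a} - S))" "nths a J = []"
    by (auto simp: blocks_def)
  then have "card {i. i < length a \<and> i \<in> J} = 0" by (metis length_nths list.size(3))
  then show False using in_runsD[OF _ J(1)] by auto
qed

lemma blocks_empty: "a \<noteq> [] \<Longrightarrow> blocks a {} = [a]"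
  by (simp add: blocks_def runs_lessThan nths_all)

lemma blocks_eq_Nil_iff: "S \<subseteq> {..<length a} \<Longrightarrow> blocks a S = [] \<longleftrightarrow> S = {..<length a}"
  by (auto simp: blocks_def runs_eq_Nil_iff)

lemma length_nths_le: "finite J \<Longrightarrow> length (nths a J) \<le> card J"
  unfolding length_nths by (rule card_mono) auto

lemma length_nths_subset:
  assumes "S \<subseteq> {..<length a}" shows "length (nths a S) = card S"
proof -
  have "{i. i < length a \<and> i \<in> S} = S" using assms by auto
  then show ?thesis by (simp add: length_nths)
qed

definition letters :: "'a list list \<Rightarrow> nat"
  where "letters as = sum_list (map length as)"

lemma letters_simps [simp]:
  "letters [] = 0" "letters (a # as) = length a + letters as"
  "letters (as @ bs) = letters as + letters bs"
  by (simp_all add: letters_def)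

text \<open>
  The first letter lies in \<open>S\<close> and is therefore missing from the blocks. All inductions on the number
  of letters rest on this.
\<close>
lemma letters_blocks_less:
  assumes "S \<subseteq> {..<length a}" "0 \<in> S"
  shows "letters (blocks a S) < length a"
proof -
  let ?U = "{..<length a} - S"
  have "letters (blocks a S) \<le> sum_list (map card (runs ?U))"
    unfolding letters_def blocks_def map_map comp_def
  proof (rule sum_list_mono)
    fix J assume "J \<in> set (runs ?U)"
    then have "finite J" using in_runsD[of ?U J] by (auto intro: finite_subset)
    then show "length (nths a J) \<le> card J" by (rule length_nths_le)
  qed
  also have "\<dots> \<le> card ?U" by (rule sum_card_runs) simp
  also have "\<dots> < length a"
    using assms psubset_card_mono[of "{..<length a}" ?U] by auto
  finally show ?thesis .
qed

lemma nths_letter: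
  "nths (us @ [x] @ vs) J =
    nths us J @ (if length us \<in> J then [x] else []) @ nths vs {j. Suc (j + length us) \<in> J}"
  by (simp add: nths_append nths_Cons)

lemma blocks_letter_in:
  "length us \<in> S \<Longrightarrow> blocks (us @ [x] @ vs) S = blocks (us @ [y] @ vs) S"
proof -
  assume S: "length us \<in> S"
  let ?U = "{..<length (us @ [x] @ vs)} - S"
  have "length us \<notin> J" if "J \<in> set (runs ?U)" for J
    using in_runsD[OF _ that] S by auto
  then show ?thesis by (auto simp: blocks_def nths_letter simp del: append.simps)
qed

lemma blocks_letter_notin:
  assumes "length us \<notin> S"
  obtains bs l r cs where "\<And>x. blocks (us @ [x] @ vs) S = bs @ [l @ [x] @ r] @ cs"
proof -
  let ?U = "{..<length us + Suc (length vs)} - S"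
  have "length us \<in> ?U" using assms by simp
  then obtain Js J Ks where J: "runs ?U = Js @ [J] @ Ks" "length us \<in> J"
    "\<And>K. K \<in> set (Js @ Ks) \<Longrightarrow> length us \<notin> K"
    by (rule runs_split[rotated]) (simp, blast)
  let ?n = "\<lambda>J. nths us J @ nths vs {j. Suc (j + length us) \<in> J}"
  have "blocks (us @ [x] @ vs) S = map ?n Js @
      [nths us J @ [x] @ nths vs {j. Suc (j + length us) \<in> J}] @ map ?n Ks" for x
    using J(2,3) unfolding blocks_def by (simp add: J(1)[simplified] nths_letter[simplified])
  then show ?thesis by (rule that)
qed

text \<open>
  The common shape of the half-coproduct, of the recursion defining a cumulant form, and of the
  fixed point equation, restricted to a single word: \<open>K\<close> is fed with the subword that contains
  the first letter, \<open>H\<close> with the blocks of the remaining letters.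
\<close>

definition left_sum ::
  "('a list \<Rightarrow> 'k::comm_ring) \<Rightarrow> ('a list list \<Rightarrow> 'k) \<Rightarrow> 'a list \<Rightarrow> 'k"
  where "left_sum K H a = (\<Sum>S | S \<subseteq> {..<length a} \<and> 0 \<in> S. K (nths a S) * H (blocks a S))"

lemma left_sum_cong:
  assumes "\<And>S. S \<subseteq> {..<length a} \<Longrightarrow> 0 \<in> S \<Longrightarrow>
    K (nths a S) * H (blocks a S) = K' (nths a S) * H' (blocks a S)"
  shows "left_sum K H a = left_sum K' H' a"
  unfolding left_sum_def by (rule sum.cong) (use assms in blast)+

text \<open>
  The subset \<open>S\<close> of all letters contributes the word itself; it is the only term in which \<open>K\<close> sees
  a word of full length.
\<close>

lemma left_sum_full:
  assumes "a \<noteq> []"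
  shows "left_sum K H a =
    K a * H [] + left_sum (\<lambda>b. if length b < length a then K b else 0) H a"
proof -
  let ?A = "{S. S \<subseteq> {..<length a} \<and> 0 \<in> S}" and ?F = "{..<length a}"
  have fin: "finite ?A" by simp
  have F: "?F \<in> ?A" using assms by auto
  have short: "length (nths a S) < length a" if "S \<in> ?A - {?F}" for S
    using that psubset_card_mono[of ?F S] by (auto simp: length_nths_subset)
  have "left_sum K H a = K a * H [] + (\<Sum>S\<in>?A - {?F}. K (nths a S) * H (blocks a S))"
    unfolding left_sum_def sum.remove[OF fin F] by (simp add: blocks_def runs_def)
  also have "(\<Sum>S\<in>?A - {?F}. K (nths a S) * H (blocks a S)) =
      (\<Sum>S\<in>?A - {?F}. (if length (nths a S) < length a then K (nths a S) else 0) * H (blocks a S))"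
    by (rule sum.cong[OF refl]) (simp only: short if_True)
  also have "\<dots> = left_sum (\<lambda>b. if length b < length a then K b else 0) H a"
    unfolding left_sum_def sum.remove[OF fin F] by simp
  finally show ?thesis .
qed

text \<open>Empty words are excluded from the context because they are not elements of \<open>T(A)\<close>.\<close>

definition blockwise_multilinear ::
  "('k::field \<Rightarrow> 'a::plus \<Rightarrow> 'a) \<Rightarrow> ('a list list \<Rightarrow> 'k) \<Rightarrow> bool"
  where "blockwise_multilinear s H \<longleftrightarrow>
    (\<forall>bs cs. [] \<notin> set (bs @ cs) \<longrightarrow> multilinear_on UNIV s (\<lambda>a. H (bs @ [a] @ cs)))"

text \<open>
  Already each term is multilinear: a letter at a position in \<open>S\<close> occurs once in the subword and in
  none of the blocks, and a letter at any other position occurs in a single block and not in the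
  subword.
\<close>
lemma left_sum_multilinear:
  assumes K: "multilinear_on UNIV s K" and H: "blockwise_multilinear s H"
  shows "multilinear_on UNIV s (left_sum K H)"
proof -
  let ?t = "\<lambda>a S. K (nths a S) * H (blocks a S)"
  have t: "?t (us @ [x + y] @ vs) S = ?t (us @ [x] @ vs) S + ?t (us @ [y] @ vs) S \<and>
      ?t (us @ [s c x] @ vs) S = c * ?t (us @ [x] @ vs) S" for us vs x y c S
  proof (cases "length us \<in> S")
    case True
    define B where "B = blocks (us @ [x] @ vs) S"
    have B: "blocks (us @ [z] @ vs) S = B" for z
      unfolding B_def by (rule blocks_letter_in[OF True])
    show ?thesis
      unfolding B nths_letter using True multilinear_onD[OF K]
      by (simp add: algebra_simps del: append_Cons append_Nil)
  next
    case False
    obtain bs l r cs where B: "\<And>z. blocks (us @ [z] @ vs) S = bs @ [l @ [z] @ r] @ cs"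
      using blocks_letter_notin[OF False] by blast
    have "[] \<notin> set (bs @ cs)" using Nil_notin_blocks[of "us @ [x] @ vs" S] B by auto
    then have H': "multilinear_on UNIV s (\<lambda>a. H (bs @ [a] @ cs))"
      using H by (simp add: blockwise_multilinear_def)
    show ?thesis
      unfolding B nths_letter using False multilinear_onD[OF H', of l r]
      by (simp add: algebra_simps del: append_Cons append_Nil)
  qed
  show ?thesis
    by (rule multilinear_onI)
      (simp_all add: left_sum_def t[simplified] sum.distrib sum_distrib_left)
qed

section \<open>The double tensor algebra\<close>

context
  fixes s :: "'k::field \<Rightarrow> 'a::ab_group_add \<Rightarrow> 'a"
begin

lemma subspace_TA_rel: "free.subspace (TA_rel s)"
  unfolding TA_rel_def by (rule subspace_tensor_alg_rel)

lemma subspace_TT_rel: "free.subspace (TT_rel s)"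
  unfolding TT_rel_def by (rule subspace_tensor_alg_rel)

lemmas TA_rel_coset = coset_plus[OF subspace_TA_rel] coset_qscale[OF subspace_TA_rel]
lemmas TT_rel_coset = coset_plus[OF subspace_TT_rel] coset_qscale[OF subspace_TT_rel]

lemma TA_plus: "x \<in> TA s \<Longrightarrow> y \<in> TA s \<Longrightarrow> x + y \<in> TA s"
  and TA_qscale: "x \<in> TA s \<Longrightarrow> qscale (TA_rel s) c x \<in> TA s"
  unfolding TA_def by (auto intro: quot_plus[OF subspace_TA_rel] quot_qscale[OF subspace_TA_rel])

lemma word_in_TA: "a \<noteq> [] \<Longrightarrow> word s a \<in> TA s"
  unfolding word_def TA_def by (rule quotI) auto

lemma words_in_TA: "[] \<notin> set as \<Longrightarrow> map (word s) as \<in> lists (TA s)"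
  by (induction as) (auto simp: word_in_TA)

lemma TA_rel_supported: "TA_rel s \<subseteq> supported_in (lists UNIV - {[]})"
  unfolding TA_rel_def by (rule tensor_alg_rel_supported) auto

lemma TT_rel_supported: "TT_rel s \<subseteq> supported_in (lists (TA s) - {[]})"
  unfolding TT_rel_def by (rule tensor_alg_rel_supported) (auto intro: TA_plus TA_qscale)

lemma TA_E:
  assumes "w \<in> TA s"
  obtains p where "p \<in> supported_in (lists UNIV - {[]})" "w = p +o TA_rel s"
  using assms unfolding TA_def by (rule quotE)

lemma TTbar_E:
  assumes "X \<in> TTbar s"
  obtains p where "p \<in> supported_in (lists (TA s))" "X = p +o TT_rel s"
  using assms unfolding TTbar_def by (rule quotE)

lemma TTbar_I: "p \<in> supported_in (lists (TA s)) \<Longrightarrow> p +o TT_rel s \<in> TTbar s"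
  unfolding TTbar_def by (rule quotI)

lemma TTbar_plus: "X \<in> TTbar s \<Longrightarrow> Y \<in> TTbar s \<Longrightarrow> X + Y \<in> TTbar s"
  and TTbar_qscale: "X \<in> TTbar s \<Longrightarrow> qscale (TT_rel s) c X \<in> TTbar s"
  unfolding TTbar_def by (auto intro: quot_plus[OF subspace_TT_rel] quot_qscale[OF subspace_TT_rel])

lemma bars_in_TTbar: "ws \<in> lists (TA s) \<Longrightarrow> bars s ws \<in> TTbar s"
  unfolding bars_def by (rule TTbar_I) simp

lemma one_in_TTbar: "one_TT s \<in> TTbar s"
  unfolding one_TT_def by (rule bars_in_TTbar) simp

lemma TT_subset: "TT s \<subseteq> TTbar s"
  unfolding TT_def TTbar_def quot_def by blast

lemma bars_in_TT: "ws \<in> lists (TA s) \<Longrightarrow> ws \<noteq> [] \<Longrightarrow> bars s ws \<in> TT s"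
  unfolding bars_def TT_def by (rule quotI) simp

lemma word_plus: "word s (us @ [x + y] @ vs) = word s (us @ [x] @ vs) + word s (us @ [y] @ vs)"
  unfolding word_def TA_rel_def by (rule gen_coset_plus) auto

lemma word_scale: "word s (us @ [s c x] @ vs) = qscale (TA_rel s) c (word s (us @ [x] @ vs))"
  unfolding word_def TA_rel_def by (rule gen_coset_scale) auto

lemma bars_plus:
  assumes "us \<in> lists (TA s)" "vs \<in> lists (TA s)" "x \<in> TA s" "y \<in> TA s"
  shows "bars s (us @ [x + y] @ vs) = bars s (us @ [x] @ vs) + bars s (us @ [y] @ vs)"
  unfolding bars_def TT_rel_def by (rule gen_coset_plus) (use assms in auto)

lemma bars_scale:
  assumes "us \<in> lists (TA s)" "vs \<in> lists (TA s)" "x \<in> TA s"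
  shows "bars s (us @ [qscale (TA_rel s) c x] @ vs) = qscale (TT_rel s) c (bars s (us @ [x] @ vs))"
  unfolding bars_def TT_rel_def by (rule gen_coset_scale) (use assms in auto)

lemma qscale_0_bars: "qscale (TT_rel s) 0 (bars s ws) = TT_rel s"
  unfolding bars_def TT_rel_coset by simp

lemma qscale_0_word: "qscale (TA_rel s) 0 (word s a) = TA_rel s"
  unfolding word_def TA_rel_coset by simp

lemma TA_rel_in_TA: "TA_rel s \<in> TA s"
  using TA_qscale[OF word_in_TA[of "[undefined]"], of 0] by (simp add: qscale_0_word)

definition bar_words :: "'a list list \<Rightarrow> ('k, 'a) tens2"
  where "bar_words as = bars s (map (word s) as)"

lemma bar_words_in_TTbar: "[] \<notin> set as \<Longrightarrow> bar_words as \<in> TTbar s"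
  unfolding bar_words_def by (intro bars_in_TTbar words_in_TA)

lemma bar_words_Nil: "bar_words [] = one_TT s"
  by (simp add: bar_words_def one_TT_def)

text \<open>
  The bars of words span the double tensor algebra. The entries of a bar product are replaced by
  words one at a time, from left to right, using linearity in the entry at hand.
\<close>
lemma TTbar_induct [consumes 1, case_names words add scale]:
  assumes "X \<in> TTbar s"
    and words: "\<And>as. [] \<notin> set as \<Longrightarrow> P (bar_words as)"
    and add: "\<And>X Y. X \<in> TTbar s \<Longrightarrow> Y \<in> TTbar s \<Longrightarrow> P X \<Longrightarrow> P Y \<Longrightarrow> P (X + Y)"
    and scale: "\<And>c X. X \<in> TTbar s \<Longrightarrow> P X \<Longrightarrow> P (qscale (TT_rel s) c X)"
  shows "P X"
proof -
  have "P (bars s (map (word s) as @ ws))" if "ws \<in> lists (TA s)" "[] \<notin> set as" for ws as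
    using that
  proof (induction ws arbitrary: as rule: lists.induct)
    case Nil
    then show ?case using words[of as] by (simp add: bar_words_def)
  next
    case (Cons w ws)
    let ?B = "\<lambda>w. bars s (map (word s) as @ [w] @ ws)"
    have as: "map (word s) as \<in> lists (TA s)" using Cons.prems by (rule words_in_TA)
    have B: "?B w \<in> TTbar s" if "w \<in> TA s" for w
      by (intro bars_in_TTbar) (use as that Cons.hyps in auto)
    have at_word: "P (?B (word s a))" if "a \<noteq> []" for a
      using Cons.IH[of "as @ [a]"] that Cons.prems by simp
    have "P (?B w)"
      using Cons.hyps(1) unfolding TA_def
    proof (induction rule: quot_induct[OF subspace_TA_rel, consumes 1, case_names zero gen add scale])
      case zero
      show ?case
        using scale[OF B at_word, of "[undefined]" 0] as Cons.hyps word_in_TA[of "[undefined]"]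
        by (simp add: qscale_0_word bars_scale[simplified, symmetric])
    next
      case (gen a)
      then show ?case unfolding word_def[symmetric] by (intro at_word) simp
    next
      case (add x y)
      then show ?case
        using assms(3)[of "?B x" "?B y"] B as Cons.hyps bars_plus[of _ ws x y]
        by (simp add: TA_def)
    next
      case (scale c x)
      then show ?case
        using assms(4)[of "?B x"] B as Cons.hyps bars_scale[of _ ws x]
        by (simp add: TA_def)
    qed
    then show ?case by simp
  qed
  from this[where as = "[]"] have bars: "P (bars s ws)" if "ws \<in> lists (TA s)" for ws
    using that by simp
  show ?thesis
    using assms(1) unfolding TTbar_def
  proof (induction rule: quot_induct[OF subspace_TT_rel, consumes 1, case_names zero gen add scale])
    case zero
    show ?case using scale[OF bars_in_TTbar bars, of "[]" 0] by (simp add: qscale_0_bars)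
  qed (use bars add scale in \<open>auto simp: bars_def TTbar_def\<close>)
qed

subsection \<open>Linear forms\<close>

definition linear_form :: "(('k, 'a) tens2 \<Rightarrow> 'k) \<Rightarrow> bool"
  where "linear_form f \<longleftrightarrow>
    (\<forall>X\<in>TTbar s. \<forall>Y\<in>TTbar s. f (X + Y) = f X + f Y) \<and>
    (\<forall>c. \<forall>X\<in>TTbar s. f (qscale (TT_rel s) c X) = c * f X)"

lemma lin_forms_iff: "f \<in> lin_forms s \<longleftrightarrow> f \<in> extensional (TTbar s) \<and> linear_form f"
  by (auto simp: lin_forms_def linear_form_def)

lemma linear_formD:
  assumes "linear_form f" "X \<in> TTbar s"
  shows "Y \<in> TTbar s \<Longrightarrow> f (X + Y) = f X + f Y" "f (qscale (TT_rel s) c X) = c * f X"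
  using assms by (auto simp: linear_form_def)

lemma linear_formI:
  assumes "\<And>X Y. X \<in> TTbar s \<Longrightarrow> Y \<in> TTbar s \<Longrightarrow> f (X + Y) = f X + f Y"
    and "\<And>c X. X \<in> TTbar s \<Longrightarrow> f (qscale (TT_rel s) c X) = c * f X"
  shows "linear_form f"
  using assms by (auto simp: linear_form_def)

lemma linear_form_cong:
  assumes "linear_form f" "\<And>X. X \<in> TTbar s \<Longrightarrow> g X = f X"
  shows "linear_form g"
  by (rule linear_formI) (use assms in \<open>auto simp: linear_formD TTbar_plus TTbar_qscale\<close>)

lemma linear_form_combine: "linear_form f \<Longrightarrow> linear_form g \<Longrightarrow> linear_form (\<lambda>X. a * f X + b * g X)"
  by (rule linear_formI) (simp_all add: linear_formD algebra_simps)

lemma linear_form_eqI: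
  assumes "linear_form f" "linear_form g"
    and "\<And>as. [] \<notin> set as \<Longrightarrow> f (bar_words as) = g (bar_words as)"
  shows "X \<in> TTbar s \<Longrightarrow> f X = g X"
  by (induction X rule: TTbar_induct) (use assms in \<open>simp_all add: linear_formD\<close>)

text \<open>
  With the next lemma, this computes a linear form from its values on bars of words.
\<close>
lemma linear_form_coset:
  assumes f: "linear_form f" and "p \<in> supported_in (lists (TA s))"
  shows "f (p +o TT_rel s) = lext (\<lambda>ws. f (bars s ws)) p"
  using assms(2)
proof (induction rule: free_induct)
  case zero
  show ?case
    using linear_formD(2)[OF f one_in_TTbar, of 0]
    by (simp add: one_TT_def qscale_0_bars lext_simps)
next
  case (gen ws)
  show ?case by (simp add: bars_def lext_simps)
next
  case (add p q)
  then show ?case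
    using linear_formD(1)[OF f TTbar_I TTbar_I, of p q] by (simp add: TT_rel_coset lext_simps)
next
  case (scale c p)
  then show ?case
    using linear_formD(2)[OF f TTbar_I, of p c] by (simp add: TT_rel_coset lext_simps)
qed

lemma linear_form_entry:
  assumes f: "linear_form f" and us: "us \<in> lists (TA s)" and vs: "vs \<in> lists (TA s)"
    and "p \<in> supported_in (lists UNIV - {[]})"
  shows "f (bars s (us @ [p +o TA_rel s] @ vs)) = lext (\<lambda>a. f (bars s (us @ [word s a] @ vs))) p"
proof -
  let ?B = "\<lambda>w. bars s (us @ [w] @ vs)"
  have B: "?B w \<in> TTbar s" if "w \<in> TA s" for w
    by (intro bars_in_TTbar) (use us vs that in auto)
  have plus: "f (?B (x + y)) = f (?B x) + f (?B y)" if "x \<in> TA s" "y \<in> TA s" for x y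
    unfolding bars_plus[OF us vs that] by (rule linear_formD(1)[OF f B B]) (use that in auto)
  have scale: "f (?B (qscale (TA_rel s) c x)) = c * f (?B x)" if "x \<in> TA s" for c x
    unfolding bars_scale[OF us vs that] by (rule linear_formD(2)[OF f B[OF that]])
  have TA: "p +o TA_rel s \<in> TA s" if "p \<in> supported_in (lists UNIV - {[]})" for p
    unfolding TA_def using that by (rule quotI)
  show ?thesis
    using assms(4)
  proof (induction rule: free_induct)
    case zero
    show ?case
      using scale[OF TA_rel_in_TA, of 0] coset_qscale[OF subspace_TA_rel, of 0 0]
      by (simp add: lext_simps)
  next
    case (gen a)
    show ?case by (simp add: word_def lext_simps)
  next
    case (add p q)
    then show ?case using plus[OF TA TA, of p q] by (simp add: TA_rel_coset lext_simps)
  next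
    case (scale c p)
    then show ?case
      using \<open>\<And>c x. x \<in> TA s \<Longrightarrow> f (?B (qscale (TA_rel s) c x)) = c * f (?B x)\<close>[OF TA, of p c]
      by (simp add: TA_rel_coset lext_simps)
  qed
qed

lemma linear_form_multilinear:
  assumes f: "linear_form f"
  shows "multilinear_on (TA s) (qscale (TA_rel s)) (\<lambda>ws. f (bars s ws))"
proof (rule multilinear_onI)
  fix us vs x y
  assume "us \<in> lists (TA s)" "vs \<in> lists (TA s)" "x \<in> TA s" "y \<in> TA s"
  then show "f (bars s (us @ [x + y] @ vs)) = f (bars s (us @ [x] @ vs)) + f (bars s (us @ [y] @ vs))"
    by (subst bars_plus) (auto intro!: linear_formD(1)[OF f] bars_in_TTbar)
next
  fix us vs x c
  assume "us \<in> lists (TA s)" "vs \<in> lists (TA s)" "x \<in> TA s"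
  then show "f (bars s (us @ [qscale (TA_rel s) c x] @ vs)) = c * f (bars s (us @ [x] @ vs))"
    by (subst bars_scale) (auto intro!: linear_formD(2)[OF f] bars_in_TTbar)
qed

lemma linear_form_blockwise:
  assumes "linear_form f" "[] \<notin> set cs"
  shows "blockwise_multilinear s (\<lambda>bs. f (bar_words (bs @ cs)))"
proof -
  note F = multilinear_onD[OF linear_form_multilinear[OF assms(1)]]
  have "f (bar_words ((bs @ [us @ [x + y] @ vs] @ ds) @ cs)) =
      f (bar_words ((bs @ [us @ [x] @ vs] @ ds) @ cs)) + f (bar_words ((bs @ [us @ [y] @ vs] @ ds) @ cs))"
    "f (bar_words ((bs @ [us @ [s c x] @ vs] @ ds) @ cs)) =
      c * f (bar_words ((bs @ [us @ [x] @ vs] @ ds) @ cs))"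
    if "[] \<notin> set (bs @ ds)" for bs ds us vs x y c
    using F(1)[of "map (word s) bs" "map (word s) (ds @ cs)"
        "word s (us @ [x] @ vs)" "word s (us @ [y] @ vs)"]
      F(2)[of "map (word s) bs" "map (word s) (ds @ cs)" "word s (us @ [x] @ vs)" c]
      words_in_TA[of bs] words_in_TA[of ds] words_in_TA[of cs] that assms(2)
    by (simp_all add: bar_words_def word_plus[simplified] word_scale[simplified] word_in_TA)
  then show ?thesis unfolding blockwise_multilinear_def by (auto intro!: multilinear_onI)
qed

lemma linear_form_klift:
  assumes "multilinear_on (TA s) (qscale (TA_rel s)) F"
  shows "linear_form (klift F)"
  by (rule linear_formI)
    (use klift_multilinear_plus[OF assms] klift_multilinear_qscale[OF assms] in
      \<open>auto simp: TTbar_def TT_rel_def\<close>)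

lemma klift_bars:
  assumes "multilinear_on (TA s) (qscale (TA_rel s)) F"
  shows "klift F (bars s ws) = F ws"
  unfolding bars_def TT_rel_def klift_multilinear[OF assms] by (simp add: lext_simps)

lemma multilinear_aug:
  "multilinear_on (TA s) (qscale (TA_rel s)) (\<lambda>ws. if ws = [] then 1 else 0)"
  by (rule multilinear_onI) auto

lemma linear_form_aug: "linear_form (aug s)"
  by (rule linear_form_cong[OF linear_form_klift[OF multilinear_aug]]) (simp add: aug_def)

lemma aug_bars: "ws \<in> lists (TA s) \<Longrightarrow> aug s (bars s ws) = (if ws = [] then 1 else 0)"
  using klift_bars[OF multilinear_aug, of ws] by (simp add: aug_def bars_in_TTbar)

lemma aug_one: "aug s (one_TT s) = 1"
  using aug_bars[of "[]"] by (simp add: one_TT_def)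

lemma aug_bar_words: "[] \<notin> set as \<Longrightarrow> aug s (bar_words as) = (if as = [] then 1 else 0)"
  unfolding bar_words_def by (simp add: aug_bars words_in_TA)

subsection \<open>The bar product\<close>

lemma TT_rel_concat:
  assumes "r \<in> TT_rel s" "us \<in> lists (TA s)"
  shows "lin_ext fscale (\<lambda>ws. gen (us @ ws)) r \<in> TT_rel s"
    and "lin_ext fscale (\<lambda>ws. gen (ws @ us)) r \<in> TT_rel s"
  using tensor_alg_rel_concat[of r _ _ us "[]"] tensor_alg_rel_concat[of r _ _ "[]" us] assms
  by (simp_all add: TT_rel_def)

lemma bar_mult_coset:
  assumes "p \<in> supported_in (lists (TA s))" "q \<in> supported_in (lists (TA s))"
  shows "bar_mult s (p +o TT_rel s) (q +o TT_rel s) =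
    lin_ext fscale (\<lambda>us. lin_ext fscale (\<lambda>vs. gen (us @ vs)) q) p +o TT_rel s"
  unfolding bar_mult_def
  by (rule qlift2_coset[OF subspace_TT_rel _ _ _ assms])
    (use TT_rel_supported TT_rel_concat in \<open>auto simp: supported_in_def\<close>)

lemma bar_mult_bars:
  "us \<in> lists (TA s) \<Longrightarrow> vs \<in> lists (TA s) \<Longrightarrow> bar_mult s (bars s us) (bars s vs) = bars s (us @ vs)"
  unfolding bars_def by (subst bar_mult_coset) (auto simp: bars_def)

lemma bar_mult_closed: "X \<in> TTbar s \<Longrightarrow> Y \<in> TTbar s \<Longrightarrow> bar_mult s X Y \<in> TTbar s"
  by (elim TTbar_E, simp add: bar_mult_coset)
    (intro TTbar_I free.lin_ext_in_subspace[OF subspace_supported_in],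
      auto simp: supported_in_def)

lemma bar_mult_linear:
  assumes "X \<in> TTbar s" "Y \<in> TTbar s" "Z \<in> TTbar s"
  shows "bar_mult s (X + Y) Z = bar_mult s X Z + bar_mult s Y Z"
    and "bar_mult s Z (X + Y) = bar_mult s Z X + bar_mult s Z Y"
    and "bar_mult s (qscale (TT_rel s) c X) Z = qscale (TT_rel s) c (bar_mult s X Z)"
    and "bar_mult s Z (qscale (TT_rel s) c X) = qscale (TT_rel s) c (bar_mult s Z X)"
  using assms
  by (auto elim!: TTbar_E simp: TT_rel_coset bar_mult_coset free.lin_ext_add free.lin_ext_scale
      free.subspace_add[OF subspace_supported_in] free.subspace_scale[OF subspace_supported_in]
      free.lin_ext_fun_add free.lin_ext_fun_scale)

lemma linear_form_bar_mult:
  assumes "linear_form f" "Z \<in> TTbar s"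
  shows "linear_form (\<lambda>X. f (bar_mult s X Z))" "linear_form (\<lambda>X. f (bar_mult s Z X))"
  by (rule linear_formI; simp add: assms bar_mult_linear bar_mult_closed linear_formD)+

lemma bilinear_eqI:
  assumes "\<And>Z. Z \<in> TTbar s \<Longrightarrow> linear_form (\<lambda>X. f X Z)" "\<And>Z. Z \<in> TTbar s \<Longrightarrow> linear_form (f Z)"
    and "\<And>Z. Z \<in> TTbar s \<Longrightarrow> linear_form (\<lambda>X. g X Z)" "\<And>Z. Z \<in> TTbar s \<Longrightarrow> linear_form (g Z)"
    and "\<And>as bs. [] \<notin> set as \<Longrightarrow> [] \<notin> set bs \<Longrightarrow>
      f (bar_words as) (bar_words bs) = g (bar_words as) (bar_words bs)"
    and "X \<in> TTbar s" "Y \<in> TTbar s"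
  shows "f X Y = g X Y"
proof (rule linear_form_eqI[OF _ _ _ assms(7)])
  show "linear_form (f X)" "linear_form (g X)" using assms by auto
  fix bs :: "'a list list" assume bs: "[] \<notin> set bs"
  show "f X (bar_words bs) = g X (bar_words bs)"
    by (rule linear_form_eqI[OF assms(1,3) _ assms(6)])
      (use bs assms(5) in \<open>auto intro: bar_words_in_TTbar\<close>)
qed

lemma bar_mult_bar_words:
  "[] \<notin> set as \<Longrightarrow> [] \<notin> set bs \<Longrightarrow>
    bar_mult s (bar_words as) (bar_words bs) = bar_words (as @ bs)"
  unfolding bar_words_def by (simp add: bar_mult_bars words_in_TA)

lemma linear_form_scaled: "linear_form f \<Longrightarrow> linear_form (\<lambda>X. c * f X)" "linear_form f \<Longrightarrow> linear_form (\<lambda>X. f X * c)"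
  by (rule linear_formI; simp add: linear_formD algebra_simps)+

lemma aug_bar_mult:
  assumes "X \<in> TTbar s" "Y \<in> TTbar s"
  shows "aug s (bar_mult s X Y) = aug s X * aug s Y"
  by (rule bilinear_eqI[OF _ _ _ _ _ assms])
    (auto intro: linear_form_bar_mult linear_form_aug linear_form_scaled
      simp: bar_mult_bar_words aug_bar_words)

end
section \<open>Pairings with the coproducts\<close>

abbreviation pair_form :: "('x \<Rightarrow> 'k::field) \<Rightarrow> ('y \<Rightarrow> 'k) \<Rightarrow> 'x \<times> 'y \<Rightarrow> 'k"
  where "pair_form f g \<equiv> \<lambda>(X, Y). f X * g Y"

context
  fixes s :: "'k::field \<Rightarrow> 'a::ab_group_add \<Rightarrow> 'a"
begin

lemma subspace_sq_rel: "free.subspace (sq_rel s)"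
  unfolding sq_rel_def tensor_prod_rel_def by (rule free.subspace_span)

lemma sq_rel_supported: "sq_rel s \<subseteq> supported_in (TTbar s \<times> TTbar s)"
  unfolding sq_rel_def tensor_prod_rel_def
proof (rule free.span_minimal)
  note [intro!] = free.subspace_diff[OF subspace_supported_in] free.subspace_scale[OF subspace_supported_in]
  show "{gen (x + x', y) - gen (x, y) - gen (x', y) | x x' y. x \<in> TTbar s \<and> x' \<in> TTbar s \<and> y \<in> TTbar s} \<union>
     {gen (x, y + y') - gen (x, y) - gen (x, y') | x y y'. x \<in> TTbar s \<and> y \<in> TTbar s \<and> y' \<in> TTbar s} \<union>
     {gen (qscale (TT_rel s) c x, y) - fscale c (gen (x, y)) | c x y. x \<in> TTbar s \<and> y \<in> TTbar s} \<union>
     {gen (x, qscale (TT_rel s) c y) - fscale c (gen (x, y)) | c x y. x \<in> TTbar s \<and> y \<in> TTbar s}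
     \<subseteq> supported_in (TTbar s \<times> TTbar s)"
    by (auto simp: TTbar_plus TTbar_qscale)
qed (rule subspace_supported_in)

lemma pair_form_sq_rel:
  assumes f: "linear_form s f" and g: "linear_form s g" and "r \<in> sq_rel s"
  shows "lext (pair_form f g) r = 0"
proof -
  have "sq_rel s \<subseteq> {r. lext (pair_form f g) r = 0}"
    unfolding sq_rel_def tensor_prod_rel_def
  proof (rule free.span_minimal)
    show "free.subspace {r. lext (pair_form f g) r = 0}"
      by (auto simp: free.subspace_def lext_simps)
  qed (auto simp: lext_simps linear_formD[OF f] linear_formD[OF g] distrib_left distrib_right)
  with assms(3) show ?thesis by blast
qed

lemma tensor_evaluates:
  assumes "linear_form s f" "linear_form s g"
  shows "evaluates (pair_form f g) (tensor s X Y) (f X * g Y)"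
  using evaluates_coset[OF free.subspace_0[OF subspace_sq_rel] pair_form_sq_rel[OF assms], of "gen (X, Y)"]
  by (simp add: tensor_def lext_simps)

lemma tensor_supported:
  "X \<in> TTbar s \<Longrightarrow> Y \<in> TTbar s \<Longrightarrow> tensor s X Y \<subseteq> supported_in (TTbar s \<times> TTbar s)"
  unfolding tensor_def
  by (rule coset_subset_subspace[OF subspace_supported_in sq_rel_supported]) simp

lemma subword_eq: "S \<noteq> {} \<Longrightarrow> subword s a S = bar_words s [nths a S]"
  by (simp add: subword_def bar_words_def)

lemma cowords_eq: "cowords s a S = bar_words s (blocks a S)"
  by (simp add: cowords_def bar_words_def blocks_def comp_def)

lemma nths_nonempty: "S \<subseteq> {..<length a} \<Longrightarrow> S \<noteq> {} \<Longrightarrow> nths a S \<noteq> []"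
  using length_nths_subset[of S a] finite_subset[of S "{..<length a}"] by auto

lemma aug_subword:
  "S \<subseteq> {..<length a} \<Longrightarrow> i \<in> S \<Longrightarrow> aug s (bar_words s [nths a S]) = 0"
  using nths_nonempty[of S a] aug_bar_words[of "[nths a S]" s] by fastforce

lemma subword_in_TTbar: "S \<subseteq> {..<length a} \<Longrightarrow> subword s a S \<in> TTbar s"
  using nths_nonempty[of S a] subword_eq[of S a]
  by (cases "S = {}") (auto simp: subword_def one_in_TTbar intro: bar_words_in_TTbar)

lemma cowords_in_TTbar: "cowords s a S \<in> TTbar s"
  unfolding cowords_eq by (rule bar_words_in_TTbar[OF Nil_notin_blocks])

lemma coprod_TA_supported: "coprod_TA s w \<subseteq> supported_in (TTbar s \<times> TTbar s)"
  and left_coprod_TA_supported: "left_coprod_TA s w \<subseteq> supported_in (TTbar s \<times> TTbar s)"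
  unfolding coprod_TA_def left_coprod_TA_def
  by (intro qlift_subset_subspace sum_subset_subspace subspace_supported_in sq_rel_supported
      tensor_supported subword_in_TTbar cowords_in_TTbar; simp)+

lemma TA_keys:
  assumes "w \<in> TA s" "p \<in> w" "a \<in> Poly_Mapping.keys p"
  shows "a \<noteq> []"
proof -
  from assms(1) obtain q where "q \<in> supported_in (lists UNIV - {[]})" "w = q +o TA_rel s"
    by (rule TA_E)
  then have "w \<subseteq> supported_in (lists UNIV - {[]})"
    using coset_subset_subspace[OF subspace_supported_in TA_rel_supported] by blast
  then show ?thesis using assms(2,3) by (auto simp: supported_in_def)
qed

lemma multilinear_bar_word:
  assumes "linear_form s f"
  shows "multilinear_on UNIV s (\<lambda>a. f (bar_words s [a]))"
  using linear_form_blockwise[OF assms, of "[]"]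
  by (auto simp: blockwise_multilinear_def dest: spec[of _ "[]"])

lemma klift_TA:
  assumes "multilinear_on UNIV s F"
  shows "klift F (p +o TA_rel s) = lext F p"
  unfolding TA_rel_def by (rule klift_multilinear[OF assms])

lemma klift_word: "multilinear_on UNIV s F \<Longrightarrow> klift F (word s a) = F a"
  by (simp add: word_def klift_TA lext_simps)

lemma evaluates_TA:
  assumes "multilinear_on UNIV s F" "w \<in> TA s"
  shows "evaluates F w (klift F w)"
  using evaluates_multilinear[OF assms(1)] klift_TA[OF assms(1)] assms(2)
  by (auto elim!: TA_E simp: TA_rel_def)

lemma multilinear_left_sum:
  assumes "linear_form s f" "linear_form s g"
  shows "multilinear_on UNIV s (left_sum (\<lambda>b. f (bar_words s [b])) (\<lambda>bs. g (bar_words s bs)))"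
  using left_sum_multilinear[OF multilinear_bar_word[OF assms(1)] linear_form_blockwise[OF assms(2), of "[]"]]
  by simp

lemma left_coprod_TA_evaluates:
  assumes f: "linear_form s f" and g: "linear_form s g" and w: "w \<in> TA s"
  shows "evaluates (pair_form f g) (left_coprod_TA s w)
    (klift (left_sum (\<lambda>b. f (bar_words s [b])) (\<lambda>bs. g (bar_words s bs))) w)"
  unfolding left_coprod_TA_def
proof (rule evaluates_qlift[OF evaluates_TA[OF multilinear_left_sum[OF f g] w] _
      free.subspace_0[OF subspace_sq_rel] pair_form_sq_rel[OF f g]])
  fix a :: "'a list"
  have "evaluates (pair_form f g)
      (\<Sum>S | S \<subseteq> {..<length a} \<and> 0 \<in> S. tensor s (subword s a S) (cowords s a S))
      (\<Sum>S | S \<subseteq> {..<length a} \<and> 0 \<in> S. f (subword s a S) * g (cowords s a S))"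
    by (rule evaluates_sum) (rule tensor_evaluates[OF f g])
  also have "(\<Sum>S | S \<subseteq> {..<length a} \<and> 0 \<in> S. f (subword s a S) * g (cowords s a S)) =
      left_sum (\<lambda>b. f (bar_words s [b])) (\<lambda>bs. g (bar_words s bs)) a"
    unfolding left_sum_def by (rule sum.cong[OF refl]) (subst subword_eq; auto simp: cowords_eq)
  finally show "evaluates (pair_form f g)
      (\<Sum>S | S \<subseteq> {..<length a} \<and> 0 \<in> S. tensor s (subword s a S) (cowords s a S))
      (left_sum (\<lambda>b. f (bar_words s [b])) (\<lambda>bs. g (bar_words s bs)) a)" .
qed

lemma bars_word_form:
  assumes g: "linear_form s g" and w: "w \<in> TA s"
  shows "g (bars s [w]) = klift (\<lambda>a. g (bar_words s [a])) w"
  using w linear_form_entry[OF g, of "[]" "[]"] klift_TA[OF multilinear_bar_word[OF g]]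
  by (auto elim!: TA_E simp: bar_words_def)

text \<open>
  Only the term \<open>S = {}\<close> survives, because a nonempty subword has positive degree.
\<close>
lemma coprod_TA_counit:
  assumes g: "linear_form s g" and w: "w \<in> TA s"
  shows "evaluates (pair_form (aug s) g) (coprod_TA s w) (g (bars s [w]))"
  unfolding coprod_TA_def bars_word_form[OF assms]
proof (rule evaluates_qlift[OF evaluates_TA[OF multilinear_bar_word[OF g] w] _
      free.subspace_0[OF subspace_sq_rel] pair_form_sq_rel[OF linear_form_aug g]])
  fix p a assume "p \<in> w" "a \<in> Poly_Mapping.keys p"
  with w have a: "a \<noteq> []" by (rule TA_keys)
  have "evaluates (pair_form (aug s) g)
      (\<Sum>S | S \<subseteq> {..<length a}. tensor s (subword s a S) (cowords s a S))
      (\<Sum>S | S \<subseteq> {..<length a}. aug s (subword s a S) * g (cowords s a S))"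
    by (rule evaluates_sum) (rule tensor_evaluates[OF linear_form_aug g])
  also have "(\<Sum>S | S \<subseteq> {..<length a}. aug s (subword s a S) * g (cowords s a S)) =
      (\<Sum>S\<in>{{}}. aug s (subword s a S) * g (cowords s a S))"
    by (rule sum.mono_neutral_right)
      (auto simp: subword_eq aug_subword)
  also have "\<dots> = g (bar_words s [a])"
    by (simp add: subword_def aug_one cowords_eq blocks_empty[OF a])
  finally show "evaluates (pair_form (aug s) g)
      (\<Sum>S | S \<subseteq> {..<length a}. tensor s (subword s a S) (cowords s a S)) (g (bar_words s [a]))" .
qed

text \<open>Linear forms on the tensor square turn its product into an iterated evaluation.\<close>

lemma sq_multE:
  assumes "z \<in> sq_mult s U V" and f: "linear_form s f" and g: "linear_form s g"
  obtains u v where "u \<in> U" "v \<in> V"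
    "lext (pair_form f g) z =
      lext (\<lambda>(X, Y). lext (\<lambda>(X', Y'). f (bar_mult s X X') * g (bar_mult s Y Y')) v) u"
proof -
  let ?m = "\<lambda>(x, y) (x', y'). (bar_mult s x x', bar_mult s y y')"
  from assms(1) obtain u v r where u: "u \<in> U" and v: "v \<in> V" and r: "r \<in> sq_rel s"
    and z: "z = (\<Sum>x\<in>Poly_Mapping.keys u. \<Sum>y\<in>Poly_Mapping.keys v.
      fscale (Poly_Mapping.lookup u x * Poly_Mapping.lookup v y) (gen (?m x y))) + r"
    unfolding sq_mult_def qlift2_def by (auto simp: elt_set_plus_def)
  have "lext (pair_form f g) z = (\<Sum>x\<in>Poly_Mapping.keys u. \<Sum>y\<in>Poly_Mapping.keys v.
      Poly_Mapping.lookup u x * Poly_Mapping.lookup v y * pair_form f g (?m x y))"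
    unfolding z
    by (simp add: lext_simps vector_space.lin_ext_sum[OF vector_space_scalars] pair_form_sq_rel[OF f g r])
  also have "\<dots> = lext (\<lambda>(X, Y). lext (\<lambda>(X', Y'). f (bar_mult s X X') * g (bar_mult s Y Y')) v) u"
    by (simp add: lin_ext_def sum_distrib_left case_prod_beta mult.assoc)
  finally show ?thesis using u v by (rule that[rotated -1])
qed

lemma sq_mult_nonempty: "U \<noteq> {} \<Longrightarrow> V \<noteq> {} \<Longrightarrow> sq_mult s U V \<noteq> {}"
  using free.subspace_0[OF subspace_sq_rel] by (fastforce simp: sq_mult_def qlift2_def elt_set_plus_def)

lemma sq_mult_supported:
  assumes U: "U \<subseteq> supported_in (TTbar s \<times> TTbar s)" and V: "V \<subseteq> supported_in (TTbar s \<times> TTbar s)"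
  shows "sq_mult s U V \<subseteq> supported_in (TTbar s \<times> TTbar s)"
  unfolding sq_mult_def qlift2_def
  by (intro UN_least coset_subset_subspace[OF subspace_supported_in sq_rel_supported]
      free.subspace_sum[OF subspace_supported_in] free.subspace_scale[OF subspace_supported_in])
    (use U V in \<open>fastforce simp: supported_in_def intro!: bar_mult_closed\<close>)

text \<open>
  The augmentation is a left counit of the coproduct. An infinitesimal character vanishes on products
  of elements of positive degree, so that on a product it sees one factor only and evaluates the others
  by the augmentation; this is how the coproducts of the entries after the first one are computed.
\<close>

lemma coprod_bars_counit:
  assumes "ws \<in> lists (TA s)"
  shows "coprod_bars s ws \<subseteq> supported_in (TTbar s \<times> TTbar s)"
    and "linear_form s h \<Longrightarrow> evaluates (pair_form (aug s) h) (coprod_bars s ws) (h (bars s ws))"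
  using assms
proof (induction ws arbitrary: h rule: lists.induct)
  case Nil
  case 1 show ?case by (simp add: coprod_bars_def tensor_supported one_in_TTbar)
  case 2 then show ?case
    using tensor_evaluates[OF linear_form_aug 2(1), of "one_TT s" "one_TT s"]
    by (simp add: coprod_bars_def aug_one one_TT_def[symmetric])
next
  case (Cons w ws)
  have ws: "ws \<in> lists (TA s)" and w: "w \<in> TA s" using Cons by auto
  have eq: "coprod_bars s (w # ws) = sq_mult s (coprod_TA s w) (coprod_bars s ws)"
    by (simp add: coprod_bars_def)
  case 1 show ?case
    unfolding eq by (intro sq_mult_supported coprod_TA_supported Cons.IH)
  case 2
  note h = 2(1)
  let ?h' = "\<lambda>Y. h (bar_mult s Y (bars s ws))"
  have h': "linear_form s ?h'"
    by (rule linear_form_bar_mult(1)[OF h bars_in_TTbar[OF ws]])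
  note first = coprod_TA_counit[OF h' w]
  have "lext (pair_form (aug s) h) z = h (bars s (w # ws))"
    if z: "z \<in> sq_mult s (coprod_TA s w) (coprod_bars s ws)" for z
  proof -
    from z linear_form_aug h obtain u v where u: "u \<in> coprod_TA s w" and v: "v \<in> coprod_bars s ws"
      and eq: "lext (pair_form (aug s) h) z =
        lext (\<lambda>(X, Y). lext (\<lambda>(X', Y'). aug s (bar_mult s X X') * h (bar_mult s Y Y')) v) u"
      by (rule sq_multE)
    have supp: "Poly_Mapping.keys u \<subseteq> TTbar s \<times> TTbar s" "Poly_Mapping.keys v \<subseteq> TTbar s \<times> TTbar s"
      using u v coprod_TA_supported Cons.IH(1) by (auto simp: supported_in_def)
    have "lext (\<lambda>(X', Y'). aug s (bar_mult s X X') * h (bar_mult s Y Y')) v = aug s X * ?h' Y"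
      if "X \<in> TTbar s" "Y \<in> TTbar s" for X Y
    proof -
      have "lext (\<lambda>(X', Y'). aug s (bar_mult s X X') * h (bar_mult s Y Y')) v =
          lext (\<lambda>x. aug s X * pair_form (aug s) (\<lambda>Y'. h (bar_mult s Y Y')) x) v"
        by (rule lin_ext_cong) (use supp that in \<open>auto simp: aug_bar_mult\<close>)
      also have "\<dots> = aug s X * ?h' Y"
        unfolding lext_fun_simps
        using evaluatesD[OF Cons.IH(2)[OF linear_form_bar_mult(2)[OF h that(2)]] v] by simp
      finally show ?thesis .
    qed
    then have "lext (pair_form (aug s) h) z = lext (pair_form (aug s) ?h') u"
      unfolding eq by (intro lin_ext_cong) (use supp in auto)
    also have "\<dots> = h (bars s (w # ws))"
      using evaluatesD[OF first u] w ws by (simp add: bar_mult_bars)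
    finally show ?thesis .
  qed
  moreover have "coprod_TA s w \<noteq> {}" "coprod_bars s ws \<noteq> {}"
    using first Cons.IH(2)[OF h] by (auto simp: evaluates_def)
  ultimately show ?case unfolding eq evaluates_def using sq_mult_nonempty by blast
qed

subsection \<open>Infinitesimal characters\<close>

lemma inf_character_linear: "\<kappa> \<in> inf_characters s \<Longrightarrow> linear_form s \<kappa>"
  and inf_character_one: "\<kappa> \<in> inf_characters s \<Longrightarrow> \<kappa> (one_TT s) = 0"
  by (auto simp: inf_characters_def lin_forms_iff)

lemma inf_character_bar_words:
  assumes "\<kappa> \<in> inf_characters s" "[] \<notin> set as" "length as \<noteq> 1"
  shows "\<kappa> (bar_words s as) = 0"
proof (cases as)
  case Nil
  then show ?thesis using inf_character_one[OF assms(1)] by (simp add: bar_words_Nil)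
next
  case (Cons a bs)
  with assms have "bs \<noteq> []" "[] \<notin> set bs" "a \<noteq> []" by auto
  then have "bar_words s [a] \<in> TT s" "bar_words s bs \<in> TT s"
    unfolding bar_words_def by (auto intro!: bars_in_TT word_in_TA words_in_TA[simplified])
  then have "\<kappa> (bar_mult s (bar_words s [a]) (bar_words s bs)) = 0"
    using assms(1) by (auto simp: inf_characters_def)
  then show ?thesis using Cons assms(2) by (simp add: bar_mult_bar_words)
qed

text \<open>
  The infinitesimal characters are the derivations into the base field, on which the algebra acts by
  the augmentation. In contrast to the vanishing on products of elements of positive degree, this form
  applies to all pairs of elements, such as those in the support of an arbitrary representative of a
  coproduct.
\<close>
lemma derivation_of_bar_words:
  assumes lin: "linear_form s \<kappa>"
    and zero: "\<And>as. [] \<notin> set as \<Longrightarrow> length as \<noteq> 1 \<Longrightarrow> \<kappa> (bar_words s as) = 0"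
    and "X \<in> TTbar s" "Y \<in> TTbar s"
  shows "\<kappa> (bar_mult s X Y) = \<kappa> X * aug s Y + aug s X * \<kappa> Y"
proof (rule bilinear_eqI[OF _ _ _ _ _ assms(3,4)])
  note aug = linear_form_aug[of s]
  fix Z assume Z: "Z \<in> TTbar s"
  show "linear_form s (\<lambda>X. \<kappa> (bar_mult s X Z))" "linear_form s (\<lambda>X. \<kappa> (bar_mult s Z X))"
    by (rule linear_form_bar_mult[OF lin Z])+
  show "linear_form s (\<lambda>X. \<kappa> X * aug s Z + aug s X * \<kappa> Z)"
    using linear_form_combine[OF lin aug, of "aug s Z" "\<kappa> Z"] by (simp add: mult.commute)
  show "linear_form s (\<lambda>X. \<kappa> Z * aug s X + aug s Z * \<kappa> X)"
    using linear_form_combine[OF aug lin, of "\<kappa> Z" "aug s Z"] by simp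
next
  fix as bs :: "'a list list" assume nil: "[] \<notin> set as" "[] \<notin> set bs"
  have "\<kappa> (bar_words s []) = 0" by (rule zero) auto
  moreover have "\<kappa> (bar_words s (as @ bs)) = 0" if "as \<noteq> []" "bs \<noteq> []"
    by (rule zero) (use nil that in \<open>auto simp: neq_Nil_conv\<close>)
  ultimately show "\<kappa> (bar_mult s (bar_words s as) (bar_words s bs)) =
      \<kappa> (bar_words s as) * aug s (bar_words s bs) + aug s (bar_words s as) * \<kappa> (bar_words s bs)"
    using nil by (auto simp: bar_mult_bar_words aug_bar_words)
qed

lemma inf_character_derivation:
  assumes \<kappa>: "\<kappa> \<in> inf_characters s" and "X \<in> TTbar s" "Y \<in> TTbar s"
  shows "\<kappa> (bar_mult s X Y) = \<kappa> X * aug s Y + aug s X * \<kappa> Y"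
  using inf_character_linear[OF \<kappa>] inf_character_bar_words[OF \<kappa>] assms(2,3)
  by (rule derivation_of_bar_words)

lemma aug_TT: "X \<in> TT s \<Longrightarrow> aug s X = 0"
proof -
  assume "X \<in> TT s"
  then obtain p where p: "p \<in> supported_in (lists (TA s) - {[]})" "X = p +o TT_rel s"
    unfolding TT_def by (rule quotE)
  then have "aug s X = lext (\<lambda>ws. aug s (bars s ws)) p"
    by (simp add: linear_form_coset[OF linear_form_aug] supported_in_def subset_iff)
  also have "\<dots> = 0"
    unfolding lin_ext_def
    by (rule sum.neutral) (use p(1) in \<open>auto simp: supported_in_def aug_bars subset_iff\<close>)
  finally show ?thesis .
qed

lemma inf_characterI:
  assumes "\<kappa> \<in> lin_forms s"
    and "\<And>as. [] \<notin> set as \<Longrightarrow> length as \<noteq> 1 \<Longrightarrow> \<kappa> (bar_words s as) = 0"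
  shows "\<kappa> \<in> inf_characters s"
proof -
  have "linear_form s \<kappa>" using assms(1) by (simp add: lin_forms_iff)
  from derivation_of_bar_words[OF this assms(2)]
  have "\<kappa> (bar_mult s X Y) = 0" if "X \<in> TT s" "Y \<in> TT s" for X Y
    using that TT_subset[of s] aug_TT by fastforce
  then show ?thesis
    using assms(2)[of "[]"] assms(1) by (simp add: inf_characters_def bar_words_Nil)
qed

text \<open>
  The value of \<open>\<kappa> \<otimes> g\<close> on the half-coproduct of \<open>w\<^sub>1|\<dots>|w\<^sub>m\<close>. The value \<open>0\<close> on the empty list makes
  it vanish on the unit, in accordance with the projection to positive degree in the half-convolution.
\<close>

definition left_pairing ::
  "(('k, 'a) tens2 \<Rightarrow> 'k) \<Rightarrow> (('k, 'a) tens2 \<Rightarrow> 'k) \<Rightarrow> ('k, 'a) tens list \<Rightarrow> 'k"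
  where "left_pairing \<kappa> g ws = (if ws = [] then 0 else
    klift (left_sum (\<lambda>b. \<kappa> (bar_words s [b]))
      (\<lambda>bs. g (bar_mult s (bar_words s bs) (bars s (tl ws))))) (hd ws))"

text \<open>
  As \<open>\<kappa>\<close> is a derivation, the value splits into two parts. In the first one \<open>\<kappa>\<close> is applied to a
  subword of the first entry, and the augmentation to the coproducts of the other entries, which by
  the counit property restores these entries. In the second part the augmentation is applied to a
  subword of the first entry; it vanishes, because this subword contains the first letter.
\<close>
lemma left_product_evaluates:
  assumes \<kappa>: "\<kappa> \<in> inf_characters s" and g: "linear_form s g"
    and w: "w \<in> TA s" and ws: "ws \<in> lists (TA s)"
  shows "evaluates (pair_form \<kappa> g) (sq_mult s (left_coprod_TA s w) (coprod_bars s ws))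
    (left_pairing \<kappa> g (w # ws))"
proof -
  note lin = inf_character_linear[OF \<kappa>]
  let ?g' = "\<lambda>Y. g (bar_mult s Y (bars s ws))"
  have g': "linear_form s ?g'"
    by (rule linear_form_bar_mult(1)[OF g bars_in_TTbar[OF ws]])
  note first = left_coprod_TA_evaluates[OF lin g' w]
  have "lext (pair_form \<kappa> g) z = left_pairing \<kappa> g (w # ws)"
    if z: "z \<in> sq_mult s (left_coprod_TA s w) (coprod_bars s ws)" for z
  proof -
    from z lin g obtain u v where u: "u \<in> left_coprod_TA s w" and v: "v \<in> coprod_bars s ws"
      and eq: "lext (pair_form \<kappa> g) z =
        lext (\<lambda>(X, Y). lext (\<lambda>(X', Y'). \<kappa> (bar_mult s X X') * g (bar_mult s Y Y')) v) u"
      by (rule sq_multE)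
    have supp: "Poly_Mapping.keys u \<subseteq> TTbar s \<times> TTbar s" "Poly_Mapping.keys v \<subseteq> TTbar s \<times> TTbar s"
      using u v left_coprod_TA_supported coprod_bars_counit(1)[OF ws] by (auto simp: supported_in_def)
    let ?H = "\<lambda>Y. lext (\<lambda>(X', Y'). \<kappa> X' * g (bar_mult s Y Y')) v"
    have "lext (\<lambda>(X', Y'). \<kappa> (bar_mult s X X') * g (bar_mult s Y Y')) v =
        \<kappa> X * ?g' Y + aug s X * ?H Y"
      if "X \<in> TTbar s" "Y \<in> TTbar s" for X Y
    proof -
      have "lext (\<lambda>(X', Y'). \<kappa> (bar_mult s X X') * g (bar_mult s Y Y')) v =
          lext (\<lambda>x. \<kappa> X * pair_form (aug s) (\<lambda>Y'. g (bar_mult s Y Y')) x +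
            aug s X * (case x of (X', Y') \<Rightarrow> \<kappa> X' * g (bar_mult s Y Y'))) v"
        by (rule lin_ext_cong)
          (use supp that in \<open>auto simp: inf_character_derivation[OF \<kappa>] algebra_simps\<close>)
      also have "\<dots> = \<kappa> X * ?g' Y + aug s X * ?H Y"
        unfolding lext_fun_simps
        using evaluatesD[OF coprod_bars_counit(2)[OF ws linear_form_bar_mult(2)[OF g that(2)]] v]
        by simp
      finally show ?thesis .
    qed
    then have "lext (pair_form \<kappa> g) z =
        lext (\<lambda>x. pair_form \<kappa> ?g' x + pair_form (aug s) ?H x) u"
      unfolding eq by (intro lin_ext_cong) (use supp in auto)
    also have "\<dots> = left_pairing \<kappa> g (w # ws) + lext (pair_form (aug s) ?H) u"
      unfolding lext_fun_simps using evaluatesD[OF first u] by (simp add: left_pairing_def)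
    also have "lext (pair_form (aug s) ?H) u = 0"
    proof -
      have "linear_form s ?H"
      proof (rule linear_formI)
        fix X Y assume XY: "X \<in> TTbar s" "Y \<in> TTbar s"
        have "?H (X + Y) = lext (\<lambda>x. (case x of (X', Y') \<Rightarrow> \<kappa> X' * g (bar_mult s X Y')) +
            (case x of (X', Y') \<Rightarrow> \<kappa> X' * g (bar_mult s Y Y'))) v"
          by (rule lin_ext_cong)
            (use supp XY in \<open>auto simp: bar_mult_linear linear_formD[OF g] bar_mult_closed algebra_simps\<close>)
        then show "?H (X + Y) = ?H X + ?H Y" unfolding lext_fun_simps .
      next
        fix X c assume X: "X \<in> TTbar s"
        have "?H (qscale (TT_rel s) c X) =
            lext (\<lambda>x. c * (case x of (X', Y') \<Rightarrow> \<kappa> X' * g (bar_mult s X Y'))) v"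
          by (rule lin_ext_cong)
            (use supp X in \<open>auto simp: bar_mult_linear linear_formD[OF g] bar_mult_closed algebra_simps\<close>)
        then show "?H (qscale (TT_rel s) c X) = c * ?H X" unfolding lext_fun_simps .
      qed
      from left_coprod_TA_evaluates[OF linear_form_aug this w]
      have "lext (pair_form (aug s) ?H) u =
          klift (left_sum (\<lambda>b. aug s (bar_words s [b])) (\<lambda>bs. ?H (bar_words s bs))) w"
        using u by (rule evaluatesD)
      also have "\<dots> = klift (\<lambda>a. 0) w"
      proof -
        have "left_sum (\<lambda>b. aug s (bar_words s [b])) (\<lambda>bs. ?H (bar_words s bs)) a = 0" for a
          unfolding left_sum_def
          by (rule sum.neutral) (auto simp: aug_subword)
        then show ?thesis by presburger
      qed
      also have "\<dots> = 0"
        using w by (auto elim!: TA_E simp: klift_TA multilinear_on_def lin_ext_def)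
      finally show ?thesis .
    qed
    finally show ?thesis by simp
  qed
  moreover have "left_coprod_TA s w \<noteq> {}" "coprod_bars s ws \<noteq> {}"
    using first coprod_bars_counit(2)[OF ws g] by (auto simp: evaluates_def)
  ultimately show ?thesis unfolding evaluates_def using sq_mult_nonempty by blast
qed

lemma left_pairing_multilinear:
  assumes \<kappa>: "linear_form s \<kappa>" and g: "linear_form s g"
  shows "multilinear_on (TA s) (qscale (TA_rel s)) (left_pairing \<kappa> g)"
proof -
  let ?L = "\<lambda>ws. left_sum (\<lambda>b. \<kappa> (bar_words s [b])) (\<lambda>bs. g (bar_mult s (bar_words s bs) (bars s ws)))"
  have L: "multilinear_on UNIV s (?L ws)" if "ws \<in> lists (TA s)" for ws
    by (rule multilinear_left_sum[OF \<kappa> linear_form_bar_mult(1)[OF g bars_in_TTbar[OF that]]])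
  note G = multilinear_onD[OF linear_form_multilinear[OF linear_form_bar_mult(2)[OF g]]]
  note bw = bar_words_in_TTbar[OF Nil_notin_blocks, of s]
  have L_plus: "?L (us @ [x + y] @ vs) a = ?L (us @ [x] @ vs) a + ?L (us @ [y] @ vs) a"
    and L_scale: "?L (us @ [qscale (TA_rel s) c x] @ vs) a = c * ?L (us @ [x] @ vs) a"
    if "us \<in> lists (TA s)" "vs \<in> lists (TA s)" "x \<in> TA s" "y \<in> TA s" for us vs x y c a
    unfolding left_sum_def using G[OF bw that(1,2,3)] that(4)
    by (simp_all add: sum.distrib sum_distrib_left distrib_left mult.left_commute del: append_Cons append_Nil)
  show ?thesis
  proof (rule multilinear_onI)
    fix us vs x y
    assume mem: "us \<in> lists (TA s)" "vs \<in> lists (TA s)" "x \<in> TA s" "y \<in> TA s"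
    show "left_pairing \<kappa> g (us @ [x + y] @ vs) =
        left_pairing \<kappa> g (us @ [x] @ vs) + left_pairing \<kappa> g (us @ [y] @ vs)"
    proof (cases us)
      case Nil
      then show ?thesis
        using klift_multilinear_plus[OF L[OF mem(2)]] mem
        by (simp add: left_pairing_def TA_def TA_rel_def)
    next
      case (Cons u us')
      then have u: "us' \<in> lists (TA s)" "u \<in> TA s" using mem by auto
      then obtain p where p: "u = p +o TA_rel s" by (auto elim: TA_E)
      have "?L (us' @ [x + y] @ vs) = (\<lambda>a. ?L (us' @ [x] @ vs) a + ?L (us' @ [y] @ vs) a)"
        using L_plus[OF u(1) mem(2-4)] by (rule ext)
      then have "lext (?L (us' @ [x + y] @ vs)) p = lext (?L (us' @ [x] @ vs)) p + lext (?L (us' @ [y] @ vs)) p"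
        by (simp only: lext_fun_simps)
      then show ?thesis
        using L[of "us' @ [x + y] @ vs"] L[of "us' @ [x] @ vs"] L[of "us' @ [y] @ vs"] u mem
        by (simp add: left_pairing_def Cons p klift_TA TA_plus)
    qed
  next
    fix us vs x c
    assume mem: "us \<in> lists (TA s)" "vs \<in> lists (TA s)" "x \<in> TA s"
    show "left_pairing \<kappa> g (us @ [qscale (TA_rel s) c x] @ vs) = c * left_pairing \<kappa> g (us @ [x] @ vs)"
    proof (cases us)
      case Nil
      then show ?thesis
        using klift_multilinear_qscale[OF L[OF mem(2)]] mem
        by (simp add: left_pairing_def TA_def TA_rel_def)
    next
      case (Cons u us')
      then have u: "us' \<in> lists (TA s)" "u \<in> TA s" using mem by auto
      then obtain p where p: "u = p +o TA_rel s" by (auto elim: TA_E)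
      have "?L (us' @ [qscale (TA_rel s) c x] @ vs) = (\<lambda>a. c * ?L (us' @ [x] @ vs) a)"
        using L_scale[OF u(1) mem(2,3,3)] by (rule ext)
      then have "lext (?L (us' @ [qscale (TA_rel s) c x] @ vs)) p = c * lext (?L (us' @ [x] @ vs)) p"
        by (simp only: lext_fun_simps)
      then show ?thesis
        using L[of "us' @ [qscale (TA_rel s) c x] @ vs"] L[of "us' @ [x] @ vs"] u mem
        by (simp add: left_pairing_def Cons p klift_TA TA_qscale)
    qed
  qed
qed

lemma left_coprod_plus_evaluates:
  assumes \<kappa>: "\<kappa> \<in> inf_characters s" and g: "linear_form s g" and X: "X \<in> TT s"
  shows "evaluates (pair_form \<kappa> g) (left_coprod_plus s X) (klift (left_pairing \<kappa> g) X)"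
proof -
  note lin = inf_character_linear[OF \<kappa>]
  note L = left_pairing_multilinear[OF lin g]
  from X obtain p where p: "p \<in> supported_in (lists (TA s) - {[]})" "X = p +o TT_rel s"
    unfolding TT_def by (rule quotE)
  have supp: "X \<subseteq> supported_in (lists (TA s) - {[]})"
    unfolding p(2) by (rule coset_subset_subspace[OF subspace_supported_in TT_rel_supported p(1)])
  have "evaluates (left_pairing \<kappa> g) X (klift (left_pairing \<kappa> g) X)"
    unfolding p(2) TT_rel_def klift_multilinear[OF L] by (rule evaluates_multilinear[OF L])
  then show ?thesis
    unfolding left_coprod_plus_def
  proof (rule evaluates_qlift[OF _ _ free.subspace_0[OF subspace_sq_rel] pair_form_sq_rel[OF lin g]])
    fix q ws assume "q \<in> X" "ws \<in> Poly_Mapping.keys q"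
    with supp have "ws \<in> lists (TA s)" "ws \<noteq> []" by (auto simp: supported_in_def)
    then show "evaluates (pair_form \<kappa> g) (sq_mult s (left_coprod_TA s (hd ws)) (coprod_bars s (tl ws)))
        (left_pairing \<kappa> g ws)"
      using left_product_evaluates[OF \<kappa> g, of "hd ws" "tl ws"] by (cases ws) auto
  qed
qed

lemma pos_part_coset:
  assumes p: "p \<in> supported_in (lists (TA s))"
  shows "pos_part (p +o TT_rel s) = (p - fscale (Poly_Mapping.lookup p []) (gen [])) +o TT_rel s"
    and "p - fscale (Poly_Mapping.lookup p []) (gen []) \<in> supported_in (lists (TA s) - {[]})"
proof -
  have single: "Poly_Mapping.single [] c = fscale c (gen [])" for c :: 'k
    by (rule poly_mapping_eqI) (simp add: gen_def lookup_single when_def)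
  have coset_image: "q +o N = (+) q ` N" for q :: "'x \<Rightarrow>\<^sub>0 'k" and N
    by (auto simp: elt_set_plus_def)
  have "Poly_Mapping.lookup r [] = 0" if "r \<in> TT_rel s" for r
  proof -
    have "[] \<notin> Poly_Mapping.keys r" using that TT_rel_supported[of s] by (auto simp: supported_in_def)
    then show ?thesis by (simp add: in_keys_iff)
  qed
  then show "pos_part (p +o TT_rel s) = (p - fscale (Poly_Mapping.lookup p []) (gen [])) +o TT_rel s"
    unfolding pos_part_def single coset_image image_image
    by (intro image_cong) (simp_all add: lookup_add)
  show "p - fscale (Poly_Mapping.lookup p []) (gen []) \<in> supported_in (lists (TA s) - {[]})"
    using p by (auto simp: supported_in_def in_keys_iff lookup_minus gen_def lookup_single when_def split: if_splits)
qed

lemma klift_TTbar: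
  assumes "multilinear_on (TA s) (qscale (TA_rel s)) F"
  shows "klift F (p +o TT_rel s) = lext F p"
  unfolding TT_rel_def by (rule klift_multilinear[OF assms])

lemma klift_pos_part:
  assumes F: "multilinear_on (TA s) (qscale (TA_rel s)) F" "F [] = 0" and X: "X \<in> TTbar s"
  shows "klift F (pos_part X) = klift F X"
proof -
  from X obtain p where p: "p \<in> supported_in (lists (TA s))" "X = p +o TT_rel s" by (rule TTbar_E)
  show ?thesis
    unfolding p(2) pos_part_coset(1)[OF p(1)] klift_TTbar[OF F(1)]
    by (simp add: lext_simps F(2))
qed

lemma pos_part_in_TT: "X \<in> TTbar s \<Longrightarrow> pos_part X \<in> TT s"
  by (elim TTbar_E) (auto simp: pos_part_coset TT_def intro: quotI)

text \<open>
  The term \<open>X \<otimes> 1\<close> by which \<open>left_coprod\<close> differs from \<open>left_coprod_plus\<close> does not contribute, since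
  \<open>g\<close> vanishes on the unit.
\<close>
lemma half_conv0_eq:
  assumes \<kappa>: "\<kappa> \<in> inf_characters s" and g: "linear_form s g" "g (one_TT s) = 0" and X: "X \<in> TTbar s"
  shows "half_conv0 s \<kappa> g X = klift (left_pairing \<kappa> g) X"
proof -
  note lin = inf_character_linear[OF \<kappa>]
  have "evaluates (pair_form \<kappa> g) (left_coprod s (pos_part X))
      (klift (left_pairing \<kappa> g) (pos_part X) + - 1 * (\<kappa> (pos_part X) * g (one_TT s)))"
    unfolding left_coprod_def
    by (intro evaluates_plus left_coprod_plus_evaluates[OF \<kappa> g(1) pos_part_in_TT[OF X]]
        evaluates_qscale tensor_evaluates lin g(1) free.subspace_0[OF subspace_sq_rel]
        pair_form_sq_rel[OF lin g(1)])
  moreover have "klift (left_pairing \<kappa> g) (pos_part X) = klift (left_pairing \<kappa> g) X"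
    by (rule klift_pos_part[OF left_pairing_multilinear[OF lin g(1)] _ X]) (simp add: left_pairing_def)
  ultimately have "evaluates (pair_form \<kappa> g) (left_coprod s (pos_part X)) (klift (left_pairing \<kappa> g) X)"
    using g(2) by simp
  then show ?thesis using X by (simp add: half_conv0_def pairing_def klift_eqI)
qed

lemma form_part_inf_character:
  assumes \<kappa>: "\<kappa> \<in> inf_characters s"
  shows "form_part s \<kappa> = \<kappa>"
proof
  fix X show "form_part s \<kappa> X = \<kappa> X"
    using \<kappa> inf_character_one[OF \<kappa>]
    by (cases "X \<in> TTbar s") (auto simp: form_part_def inf_characters_def lin_forms_def extensional_def)
qed

lemma form_part_linear:
  assumes "linear_form s g"
  shows "linear_form s (form_part s g)"
  by (rule linear_form_cong[OF linear_form_combine[OF assms linear_form_aug, of 1 "- g (one_TT s)"]])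
    (simp add: form_part_def)

lemma half_conv_eq:
  assumes \<kappa>: "\<kappa> \<in> inf_characters s" and g: "linear_form s g" and X: "X \<in> TTbar s"
  shows "half_conv s \<kappa> g X = klift (left_pairing \<kappa> (form_part s g)) X + g (one_TT s) * \<kappa> X"
proof -
  have "form_part s g (one_TT s) = 0" by (simp add: form_part_def one_in_TTbar aug_one)
  from half_conv0_eq[OF \<kappa> form_part_linear[OF g] this X] show ?thesis
    using X by (simp add: half_conv_def form_part_inf_character[OF \<kappa>])
qed

lemma half_conv_linear:
  assumes \<kappa>: "\<kappa> \<in> inf_characters s" and g: "linear_form s g"
  shows "linear_form s (half_conv s \<kappa> g)"
proof -
  note lin = inf_character_linear[OF \<kappa>]
  show ?thesis
    by (rule linear_form_cong[OF linear_form_combine[OF linear_form_klift[OF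
              left_pairing_multilinear[OF lin form_part_linear[OF g]]] lin, of 1 "g (one_TT s)"]])
      (simp add: half_conv_eq[OF \<kappa> g])
qed

lemma half_conv_one:
  assumes \<kappa>: "\<kappa> \<in> inf_characters s" and g: "linear_form s g"
  shows "half_conv s \<kappa> g (one_TT s) = 0"
  unfolding half_conv_eq[OF assms one_in_TTbar] inf_character_one[OF \<kappa>]
  by (simp add: one_TT_def klift_bars left_pairing_multilinear inf_character_linear \<kappa>
      form_part_linear g) (simp add: left_pairing_def)

text \<open>
  The key formula. In the half-coproduct of \<open>a|w\<close>, an infinitesimal character on the left leaves only
  the terms in which nothing is taken out of the bars after the first one.
\<close>
lemma half_conv_Cons:
  assumes \<kappa>: "\<kappa> \<in> inf_characters s" and g: "linear_form s g" and a: "a \<noteq> []" and as: "[] \<notin> set as"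
  shows "half_conv s \<kappa> g (bar_words s (a # as)) =
    left_sum (\<lambda>b. \<kappa> (bar_words s [b])) (\<lambda>bs. g (bar_words s (bs @ as))) a"
proof -
  note lin = inf_character_linear[OF \<kappa>]
  let ?g = "form_part s g"
  let ?K = "\<lambda>b. \<kappa> (bar_words s [b])"
  have mem: "bar_words s (a # as) \<in> TTbar s" "bar_words s as \<in> TTbar s"
    by (rule bar_words_in_TTbar; use a as in auto)+
  have fp: "?g (bar_words s (bs @ as)) = g (bar_words s (bs @ as)) - g (one_TT s) * (if bs @ as = [] then 1 else 0)"
    if "[] \<notin> set bs" for bs
    using that as bar_words_in_TTbar[of "bs @ as" s] aug_bar_words[of "bs @ as" s]
    by (simp add: form_part_def)
  have "klift (left_pairing \<kappa> ?g) (bar_words s (a # as)) =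
      left_sum ?K (\<lambda>bs. ?g (bar_mult s (bar_words s bs) (bar_words s as))) a"
    unfolding bar_words_def[of s "a # as"]
      klift_bars[OF left_pairing_multilinear[OF lin form_part_linear[OF g]]]
    by (simp add: left_pairing_def bar_words_def[of s as, symmetric])
      (rule klift_word[OF multilinear_left_sum[OF lin linear_form_bar_mult(1)[OF form_part_linear[OF g] mem(2)]]])
  also have "\<dots> = left_sum ?K (\<lambda>bs. g (bar_words s (bs @ as)) -
      g (one_TT s) * (if bs @ as = [] then 1 else 0)) a"
    by (rule left_sum_cong) (simp only: bar_mult_bar_words[OF Nil_notin_blocks as] fp[OF Nil_notin_blocks])
  also have "\<dots> = left_sum ?K (\<lambda>bs. g (bar_words s (bs @ as))) a -
      g (one_TT s) * left_sum ?K (\<lambda>bs. if bs @ as = [] then 1 else 0) a"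
    by (simp add: left_sum_def sum_subtractf sum_distrib_left right_diff_distrib mult.left_commute)
  \<comment> \<open>\<open>g\<close> and its part vanishing on the unit differ only where no block is left, that is, for a single
    word and the full subset; the difference cancels the contribution of \<open>\<kappa> \<prec> e = \<kappa>\<close>.\<close>
  also have "left_sum ?K (\<lambda>bs. if bs @ as = [] then 1 else 0) a = \<kappa> (bar_words s (a # as))"
  proof (cases "as = []")
    case True
    have "left_sum (\<lambda>b. if length b < length a then ?K b else 0) (\<lambda>bs. if bs @ as = [] then 1 else 0) a = 0"
      unfolding left_sum_def
      by (rule sum.neutral) (auto simp: blocks_eq_Nil_iff length_nths)
    then show ?thesis using True by (subst left_sum_full[OF a]) simp
  next
    case False
    then have "\<kappa> (bar_words s (a # as)) = 0"
      by (intro inf_character_bar_words[OF \<kappa>]) (use a as in auto)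
    then show ?thesis using False by (simp add: left_sum_def)
  qed
  finally show ?thesis unfolding half_conv_eq[OF \<kappa> g mem(1)] by simp
qed

end
section \<open>The fixed point equation on words\<close>

text \<open>
  The equation \<open>\<Phi> = e + \<kappa> \<prec> \<Phi>\<close>, spelled out on bars of words. By \<open>letters_blocks_less\<close> it expresses
  \<open>\<Phi>\<close> by its values on arguments with fewer letters.
\<close>
definition left_recursion ::
  "('k::field \<Rightarrow> 'a::ab_group_add \<Rightarrow> 'a) \<Rightarrow>
    (('k, 'a) tens2 \<Rightarrow> 'k) \<Rightarrow> (('k, 'a) tens2 \<Rightarrow> 'k) \<Rightarrow> bool"
  where "left_recursion s \<kappa> \<Phi> \<longleftrightarrow> \<Phi> (one_TT s) = 1 \<and>
    (\<forall>a as. a \<noteq> [] \<longrightarrow> [] \<notin> set as \<longrightarrow> \<Phi> (bar_words s (a # as)) =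
      left_sum (\<lambda>b. \<kappa> (bar_words s [b])) (\<lambda>bs. \<Phi> (bar_words s (bs @ as))) a)"

lemma left_recursionD:
  assumes "left_recursion s \<kappa> \<Phi>"
  shows "\<Phi> (bar_words s []) = 1"
    and "a \<noteq> [] \<Longrightarrow> [] \<notin> set as \<Longrightarrow> \<Phi> (bar_words s (a # as)) =
      left_sum (\<lambda>b. \<kappa> (bar_words s [b])) (\<lambda>bs. \<Phi> (bar_words s (bs @ as))) a"
  using assms by (auto simp: left_recursion_def bar_words_Nil)

lemma lin_forms_eqI:
  assumes "f \<in> lin_forms s" "g \<in> lin_forms s"
    and "\<And>as. [] \<notin> set as \<Longrightarrow> f (bar_words s as) = g (bar_words s as)"
  shows "f = g"
  by (rule extensionalityI[of _ "TTbar s"])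
    (use assms linear_form_eqI[of s f g] in \<open>auto simp: lin_forms_iff\<close>)

lemma restrict_lin_forms: "linear_form s f \<Longrightarrow> restrict f (TTbar s) \<in> lin_forms s"
  by (auto simp: lin_forms_iff intro: linear_form_cong)

lemma fixed_point_iff:
  assumes \<kappa>: "\<kappa> \<in> inf_characters s" and \<Phi>: "\<Phi> \<in> lin_forms s"
  shows "\<Phi> = (\<lambda>X\<in>TTbar s. aug s X + half_conv s \<kappa> \<Phi> X) \<longleftrightarrow> left_recursion s \<kappa> \<Phi>"
    (is "\<Phi> = ?R \<longleftrightarrow> _")
proof
  have lin: "linear_form s \<Phi>" using \<Phi> by (simp add: lin_forms_iff)
  have R_one: "?R (one_TT s) = 1"
    by (simp add: one_in_TTbar aug_one half_conv_one[OF \<kappa> lin])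
  have R_Cons: "?R (bar_words s (a # as)) =
      left_sum (\<lambda>b. \<kappa> (bar_words s [b])) (\<lambda>bs. \<Phi> (bar_words s (bs @ as))) a"
    if "a \<noteq> []" "[] \<notin> set as" for a as
    using that bar_words_in_TTbar[of "a # as" s]
    by (simp add: aug_bar_words half_conv_Cons[OF \<kappa> lin])
  show "left_recursion s \<kappa> \<Phi>" if eq: "\<Phi> = ?R"
    using R_one R_Cons unfolding left_recursion_def eq[symmetric] by blast
  show "\<Phi> = ?R" if rec: "left_recursion s \<kappa> \<Phi>"
  proof (rule lin_forms_eqI[OF \<Phi>])
    show "?R \<in> lin_forms s"
      by (rule restrict_lin_forms)
        (use linear_form_combine[OF linear_form_aug half_conv_linear[OF \<kappa> lin], of 1 1] in simp)
    fix as :: "'a list list" assume "[] \<notin> set as"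
    then show "\<Phi> (bar_words s as) = ?R (bar_words s as)"
    proof (cases as)
      case Nil
      show ?thesis unfolding Nil bar_words_Nil R_one using rec by (simp add: left_recursion_def)
    next
      case (Cons a bs)
      with \<open>[] \<notin> set as\<close> have a: "a \<noteq> []" "[] \<notin> set bs" by auto
      show ?thesis unfolding Cons R_Cons[OF a] by (rule left_recursionD(2)[OF rec a])
    qed
  qed
qed

text \<open>
  The sum on the right-hand side of the recursion touches the first word only, so that a factor on the
  right is passed on unchanged to arguments with fewer letters.
\<close>
lemma left_recursion_multiplicative:
  assumes rec: "left_recursion s \<kappa> \<Phi>"
  shows "[] \<notin> set as \<Longrightarrow> [] \<notin> set cs \<Longrightarrow>
    \<Phi> (bar_words s (as @ cs)) = \<Phi> (bar_words s as) * \<Phi> (bar_words s cs)"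
proof (induction "letters as" arbitrary: as rule: less_induct)
  case less
  show ?case
  proof (cases as)
    case Nil
    then show ?thesis using left_recursionD(1)[OF rec] by simp
  next
    case (Cons a as')
    let ?K = "\<lambda>b. \<kappa> (bar_words s [b])"
    have a: "a \<noteq> []" "[] \<notin> set as'" "[] \<notin> set (as' @ cs)" using less.prems Cons by auto
    have "\<Phi> (bar_words s (as @ cs)) = left_sum ?K (\<lambda>bs. \<Phi> (bar_words s (bs @ as' @ cs))) a"
      using left_recursionD(2)[OF rec a(1,3)] Cons by simp
    also have "\<dots> = left_sum ?K (\<lambda>bs. \<Phi> (bar_words s (bs @ as')) * \<Phi> (bar_words s cs)) a"
    proof (rule left_sum_cong)
      fix S assume "S \<subseteq> {..<length a}" "0 \<in> S"
      then have "letters (blocks a S @ as') < letters as"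
        using letters_blocks_less[of S a] Cons by simp
      from less.hyps[OF this] show "?K (nths a S) * \<Phi> (bar_words s (blocks a S @ as' @ cs)) =
          ?K (nths a S) * (\<Phi> (bar_words s (blocks a S @ as')) * \<Phi> (bar_words s cs))"
        using a less.prems Nil_notin_blocks[of a S] by simp
    qed
    also have "\<dots> = left_sum ?K (\<lambda>bs. \<Phi> (bar_words s (bs @ as'))) a * \<Phi> (bar_words s cs)"
      by (simp add: left_sum_def sum_distrib_right mult.assoc)
    also have "\<dots> = \<Phi> (bar_words s as) * \<Phi> (bar_words s cs)"
      using left_recursionD(2)[OF rec a(1,2)] Cons by simp
    finally show ?thesis .
  qed
qed

lemma left_recursion_unique:
  assumes "left_recursion s \<kappa> \<Phi>" "left_recursion s \<kappa> \<Psi>"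
  shows "[] \<notin> set as \<Longrightarrow> \<Phi> (bar_words s as) = \<Psi> (bar_words s as)"
proof (induction "letters as" arbitrary: as rule: less_induct)
  case less
  show ?case
  proof (cases as)
    case Nil
    then show ?thesis using assms[THEN left_recursionD(1)] by simp
  next
    case (Cons a as')
    have a: "a \<noteq> []" "[] \<notin> set as'" using less.prems Cons by auto
    show ?thesis
      unfolding Cons left_recursionD(2)[OF assms(1) a] left_recursionD(2)[OF assms(2) a]
    proof (rule left_sum_cong)
      fix S assume "S \<subseteq> {..<length a}" "0 \<in> S"
      then have "letters (blocks a S @ as') < letters as"
        using letters_blocks_less[of S a] Cons by simp
      from less.hyps[OF this] show "\<kappa> (bar_words s [nths a S]) * \<Phi> (bar_words s (blocks a S @ as')) =
          \<kappa> (bar_words s [nths a S]) * \<Psi> (bar_words s (blocks a S @ as'))"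
        using a Nil_notin_blocks[of a S] by simp
    qed
  qed
qed

lemma left_recursion_character:
  assumes \<Phi>: "\<Phi> \<in> lin_forms s" and rec: "left_recursion s \<kappa> \<Phi>"
  shows "\<Phi> \<in> characters s"
proof -
  have lin: "linear_form s \<Phi>" using \<Phi> by (simp add: lin_forms_iff)
  have "\<Phi> (bar_mult s X Y) = \<Phi> X * \<Phi> Y" if "X \<in> TTbar s" "Y \<in> TTbar s" for X Y
    by (rule bilinear_eqI[OF _ _ _ _ _ that])
      (auto intro: linear_form_bar_mult linear_form_scaled lin
        simp: bar_mult_bar_words left_recursion_multiplicative[OF rec])
  with \<Phi> rec show ?thesis by (auto simp: characters_def left_recursion_def)
qed

section \<open>The exponential solves the fixed point equation\<close>

context
  fixes s :: "'k::field \<Rightarrow> 'a::ab_group_add \<Rightarrow> 'a" and \<kappa> :: "('k, 'a) tens2 \<Rightarrow> 'k"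
  assumes \<kappa>: "\<kappa> \<in> inf_characters s"
begin

lemma half_pow_linear: "linear_form s (half_pow s \<kappa> n)"
  by (induction n) (simp_all add: linear_form_aug half_conv_linear[OF \<kappa>])

text \<open>
  Each half-convolution with \<open>\<kappa>\<close> uses up at least one letter.
\<close>
lemma half_pow_bar_words_0:
  "[] \<notin> set as \<Longrightarrow> letters as < n \<Longrightarrow> half_pow s \<kappa> n (bar_words s as) = 0"
proof (induction n arbitrary: as)
  case (Suc n)
  show ?case
  proof (cases as)
    case Nil
    then show ?thesis by (simp add: bar_words_Nil half_conv_one[OF \<kappa> half_pow_linear])
  next
    case (Cons a as')
    with Suc.prems have a: "a \<noteq> []" "[] \<notin> set as'" by auto
    have "half_pow s \<kappa> n (bar_words s (blocks a S @ as')) = 0"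
      if "S \<subseteq> {..<length a}" "0 \<in> S" for S
      using letters_blocks_less[OF that] Suc.prems(2) Cons a Nil_notin_blocks[of a S]
      by (intro Suc.IH) auto
    then show ?thesis
      using Cons half_conv_Cons[OF \<kappa> half_pow_linear a] by (simp add: left_sum_def)
  qed
qed simp

lemma half_pow_eventually_0:
  assumes "X \<in> TTbar s" shows "\<exists>N. \<forall>n>N. half_pow s \<kappa> n X = 0"
  using assms
proof (induction X rule: TTbar_induct)
  case (words as)
  then show ?case using half_pow_bar_words_0 by blast
next
  case (add X Y)
  then obtain M N where "\<forall>n>M. half_pow s \<kappa> n X = 0" "\<forall>n>N. half_pow s \<kappa> n Y = 0" by blast
  then have "\<forall>n>max M N. half_pow s \<kappa> n (X + Y) = 0"
    using add.hyps by (simp add: linear_formD[OF half_pow_linear])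
  then show ?case by blast
next
  case (scale c X)
  then show ?case by (auto simp: linear_formD[OF half_pow_linear])
qed

lemma half_exp_eq_sum:
  assumes X: "X \<in> TTbar s" and N: "\<And>n. n > N \<Longrightarrow> half_pow s \<kappa> n X = 0"
  shows "half_exp s \<kappa> X = (\<Sum>n\<le>N. half_pow s \<kappa> n X)"
proof -
  have "(\<Sum>n | n > 0 \<and> half_pow s \<kappa> n X \<noteq> 0. half_pow s \<kappa> n X) = (\<Sum>n\<in>{..N} - {0}. half_pow s \<kappa> n X)"
    by (rule sum.mono_neutral_left) (use N in \<open>auto simp: not_less[symmetric]\<close>)
  then show ?thesis
    using X by (simp add: half_exp_def sum.remove[of "{..N}" 0])
qed

lemma half_exp_linear: "linear_form s (half_exp s \<kappa>)"
proof (rule linear_formI)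
  fix X Y assume XY: "X \<in> TTbar s" "Y \<in> TTbar s"
  then obtain M N where "\<forall>n>M. half_pow s \<kappa> n X = 0" "\<forall>n>N. half_pow s \<kappa> n Y = 0"
    using half_pow_eventually_0 by blast
  then show "half_exp s \<kappa> (X + Y) = half_exp s \<kappa> X + half_exp s \<kappa> Y"
    using XY
    by (simp add: half_exp_eq_sum[of _ "max M N"] TTbar_plus linear_formD[OF half_pow_linear] sum.distrib)
next
  fix X c assume X: "X \<in> TTbar s"
  then obtain N where "\<forall>n>N. half_pow s \<kappa> n X = 0"
    using half_pow_eventually_0 by blast
  then show "half_exp s \<kappa> (qscale (TT_rel s) c X) = c * half_exp s \<kappa> X"
    using X
    by (simp add: half_exp_eq_sum[of _ N] TTbar_qscale linear_formD[OF half_pow_linear] sum_distrib_left)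
qed

lemma half_exp_lin_forms: "half_exp s \<kappa> \<in> lin_forms s"
  using half_exp_linear by (simp add: lin_forms_iff half_exp_def)

text \<open>
  Applying \<open>\<kappa> \<prec> _\<close> to the exponential shifts the summation index; on a given argument only finitely
  many powers are involved.
\<close>
lemma half_exp_left_recursion: "left_recursion s \<kappa> (half_exp s \<kappa>)"
  unfolding left_recursion_def
proof (intro conjI allI impI)
  have "half_pow s \<kappa> n (one_TT s) = 0" if "n > 0" for n
    using half_pow_bar_words_0[of "[]" n] that by (simp add: bar_words_Nil)
  then show "half_exp s \<kappa> (one_TT s) = 1"
    using half_exp_eq_sum[OF one_in_TTbar, of 0] by (simp add: aug_one)
next
  fix a :: "'a list" and as :: "'a list list" assume a: "a \<noteq> []" "[] \<notin> set as"
  let ?K = "\<lambda>b. \<kappa> (bar_words s [b])"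
  define N where "N = letters (a # as)"
  have sum_eq: "half_exp s \<kappa> (bar_words s cs) = (\<Sum>n\<le>M. half_pow s \<kappa> n (bar_words s cs))"
    if "[] \<notin> set cs" "letters cs \<le> M" for cs M
    by (rule half_exp_eq_sum) (use that in \<open>auto intro: bar_words_in_TTbar half_pow_bar_words_0\<close>)
  have "half_exp s \<kappa> (bar_words s (a # as)) = (\<Sum>n\<le>Suc N. half_pow s \<kappa> n (bar_words s (a # as)))"
    by (rule sum_eq) (use a in \<open>auto simp: N_def\<close>)
  also have "\<dots> = (\<Sum>n\<le>N. half_conv s \<kappa> (half_pow s \<kappa> n) (bar_words s (a # as)))"
    unfolding sum.atMost_Suc_shift using a by (simp add: aug_bar_words)
  also have "\<dots> = (\<Sum>n\<le>N. left_sum ?K (\<lambda>bs. half_pow s \<kappa> n (bar_words s (bs @ as))) a)"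
    by (simp add: half_conv_Cons[OF \<kappa> half_pow_linear a])
  also have "\<dots> = left_sum ?K (\<lambda>bs. \<Sum>n\<le>N. half_pow s \<kappa> n (bar_words s (bs @ as))) a"
    unfolding left_sum_def sum_distrib_left by (rule sum.swap)
  also have "\<dots> = left_sum ?K (\<lambda>bs. half_exp s \<kappa> (bar_words s (bs @ as))) a"
  proof (rule left_sum_cong)
    fix S assume "S \<subseteq> {..<length a}" "0 \<in> S"
    then have "letters (blocks a S @ as) \<le> N"
      using letters_blocks_less[of S a] by (simp add: N_def)
    then show "?K (nths a S) * (\<Sum>n\<le>N. half_pow s \<kappa> n (bar_words s (blocks a S @ as))) =
        ?K (nths a S) * half_exp s \<kappa> (bar_words s (blocks a S @ as))"
      using a Nil_notin_blocks[of a S] by (subst sum_eq) auto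
  qed
  finally show "half_exp s \<kappa> (bar_words s (a # as)) =
      left_sum ?K (\<lambda>bs. half_exp s \<kappa> (bar_words s (bs @ as))) a" .
qed

lemma half_exp_unique_solution:
  assumes "\<Phi> \<in> lin_forms s" "left_recursion s \<kappa> \<Phi>"
  shows "\<Phi> = half_exp s \<kappa>"
  using assms(1) half_exp_lin_forms left_recursion_unique[OF assms(2) half_exp_left_recursion]
  by (rule lin_forms_eqI)

lemma half_exp_character: "half_exp s \<kappa> \<in> characters s"
  using half_exp_lin_forms half_exp_left_recursion by (rule left_recursion_character)

end

section \<open>The infinitesimal character of a character\<close>

text \<open>
  On a single word, the term of the full subset is \<open>\<kappa>(a) \<Phi>(1) = \<kappa>(a)\<close>, and all other terms involve \<open>\<kappa>\<close>
  on shorter words only; so the recursion can be solved for \<open>\<kappa>\<close>.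
\<close>
lemma left_recursion_determines:
  assumes \<kappa>: "\<kappa> \<in> inf_characters s" "\<kappa>' \<in> inf_characters s"
    and rec: "left_recursion s \<kappa> \<Phi>" "left_recursion s \<kappa>' \<Phi>"
  shows "\<kappa> = \<kappa>'"
proof (rule lin_forms_eqI)
  show "\<kappa> \<in> lin_forms s" "\<kappa>' \<in> lin_forms s" using \<kappa> by (auto simp: inf_characters_def)
  have single: "\<kappa> (bar_words s [a]) = \<kappa>' (bar_words s [a])" if "a \<noteq> []" for a
    using that
  proof (induction "length a" arbitrary: a rule: less_induct)
    case less
    let ?H = "\<lambda>bs. \<Phi> (bar_words s bs)"
    let ?t = "\<lambda>\<kappa> b. if length b < length a then \<kappa> (bar_words s [b]) else 0"
    have same: "left_sum (?t \<kappa>) ?H a = left_sum (?t \<kappa>') ?H a"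
    proof (rule left_sum_cong)
      fix S assume "S \<subseteq> {..<length a}" "0 \<in> S"
      then show "?t \<kappa> (nths a S) * ?H (blocks a S) = ?t \<kappa>' (nths a S) * ?H (blocks a S)"
        using nths_nonempty[of S a] less.hyps[of "nths a S"] by auto
    qed
    have split: "\<Phi> (bar_words s [a]) = \<kappa> (bar_words s [a]) + left_sum (?t \<kappa>) ?H a"
      if "left_recursion s \<kappa> \<Phi>" for \<kappa>
      using left_recursionD[OF that] less.prems left_sum_full[OF less.prems, of "\<lambda>b. \<kappa> (bar_words s [b])" ?H]
      by simp
    from split[OF rec(1)] split[OF rec(2)] show ?case unfolding same by simp
  qed
  fix as :: "'a list list" assume as: "[] \<notin> set as"
  show "\<kappa> (bar_words s as) = \<kappa>' (bar_words s as)"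
  proof (cases "length as = 1")
    case True
    then show ?thesis using as single by (auto simp: length_Suc_conv)
  next
    case False
    then show ?thesis using as \<kappa> by (simp add: inf_character_bar_words)
  qed
qed

text \<open>
  The solution for \<open>\<kappa>\<close> of the recursion on single words, where \<open>H\<close> gives the values of \<open>\<Phi>\<close>. The test on
  the length removes the term of the full subset, which is the unknown, and ensures termination.
\<close>

function cumulant :: "('a list list \<Rightarrow> 'k::comm_ring_1) \<Rightarrow> 'a list \<Rightarrow> 'k" where
  "cumulant H a = H [a] - left_sum (\<lambda>b. if length b < length a then cumulant H b else 0) H a"
  by auto
termination by (relation "measure (\<lambda>(H, a). length a)") auto

declare cumulant.simps [simp del]

lemma left_sum_cumulant:
  assumes "a \<noteq> []" "H [] = 1"
  shows "left_sum (cumulant H) H a = H [a]"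
  using assms(2) by (subst left_sum_full[OF assms(1)]) (simp add: cumulant.simps[of H a])

text \<open>
  Induction on the length of the word. The words obtained by changing one letter have the same length
  \<open>n\<close>, so that one truncation of \<open>cumulant\<close> to lengths below \<open>n\<close> serves for all of them; by the induction
  hypothesis this truncation is multilinear on words of every length, and \<open>left_sum_multilinear\<close>
  applies to it.
\<close>
lemma cumulant_multilinear:
  assumes H: "blockwise_multilinear s H"
  shows "multilinear_on UNIV s (cumulant H)"
proof -
  have "cumulant H (us @ [x + y] @ vs) = cumulant H (us @ [x] @ vs) + cumulant H (us @ [y] @ vs) \<and>
      cumulant H (us @ [s c x] @ vs) = c * cumulant H (us @ [x] @ vs)" for us vs x y c
  proof (induction "length us + length vs" arbitrary: us vs x y c rule: less_induct)
    case less
    let ?n = "Suc (length us + length vs)"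
    let ?t = "\<lambda>b. if length b < ?n then cumulant H b else 0"
    have "multilinear_on UNIV s ?t"
      by (rule multilinear_onI) (use less in auto)
    note T = multilinear_onD[OF left_sum_multilinear[OF this H], of us vs]
    have "multilinear_on UNIV s (\<lambda>a. H [a])"
      using H by (auto simp: blockwise_multilinear_def dest: spec[of _ "[]"])
    note H1 = multilinear_onD[OF this, of us vs]
    have eq: "cumulant H (us @ [x] @ vs) = H [us @ [x] @ vs] - left_sum ?t H (us @ [x] @ vs)" for x
      by (subst cumulant.simps) simp
    show ?case
      unfolding eq using T H1 by (simp add: algebra_simps del: append_Cons append_Nil)
  qed
  then show ?thesis by (auto intro: multilinear_onI)
qed

text \<open>
  Infinitesimal characters are the same as linear forms on \<open>T(A)\<close>, extended by zero to products.
\<close>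
lemma exists_inf_character:
  assumes "multilinear_on UNIV s F"
  obtains \<kappa> where "\<kappa> \<in> inf_characters s" "\<And>a. a \<noteq> [] \<Longrightarrow> \<kappa> (bar_words s [a]) = F a"
proof -
  define G where "G ws = (if length ws = 1 then klift F (hd ws) else 0)" for ws
  have F: "multilinear_on UNIV s F" by fact
  have G: "multilinear_on (TA s) (qscale (TA_rel s)) G"
    by (rule multilinear_onI)
      (use klift_multilinear_plus[OF F] klift_multilinear_qscale[OF F] in
        \<open>auto simp: G_def TA_def TA_rel_def\<close>)
  let ?\<kappa> = "restrict (klift G) (TTbar s)"
  have val: "?\<kappa> (bar_words s as) = G (map (word s) as)" if "[] \<notin> set as" for as
    using bar_words_in_TTbar[OF that, of s] by (simp add: bar_words_def klift_bars[OF G])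
  have "?\<kappa> \<in> inf_characters s"
    using restrict_lin_forms[OF linear_form_klift[OF G]]
    by (rule inf_characterI) (subst val, simp_all add: G_def)
  moreover have "?\<kappa> (bar_words s [a]) = F a" if "a \<noteq> []" for a
    using that klift_word[OF F, of a] by (subst val) (auto simp: G_def)
  ultimately show ?thesis by (rule that)
qed

text \<open>
  For a multiplicative \<open>\<Phi>\<close>, the recursion on a single word implies the one on \<open>a|w\<close>, by multiplication
  with \<open>\<Phi>(w)\<close>.
\<close>
lemma character_left_recursion:
  assumes \<Phi>: "\<Phi> \<in> characters s"
  obtains \<kappa> where "\<kappa> \<in> inf_characters s" "left_recursion s \<kappa> \<Phi>"
proof -
  let ?H = "\<lambda>bs. \<Phi> (bar_words s bs)"
  have lin: "linear_form s \<Phi>" and one: "?H [] = 1"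
    using \<Phi> by (auto simp: characters_def lin_forms_iff bar_words_Nil)
  have mult: "?H (as @ bs) = ?H as * ?H bs" if "[] \<notin> set as" "[] \<notin> set bs" for as bs
    using \<Phi> bar_words_in_TTbar[of _ s] that
    by (simp add: characters_def bar_mult_bar_words[symmetric])
  obtain \<kappa> where \<kappa>: "\<kappa> \<in> inf_characters s" "\<And>a. a \<noteq> [] \<Longrightarrow> \<kappa> (bar_words s [a]) = cumulant ?H a"
    using exists_inf_character[OF cumulant_multilinear[OF linear_form_blockwise[OF lin, of "[]"]]]
    by auto
  have "?H (a # as) = left_sum (\<lambda>b. \<kappa> (bar_words s [b])) (\<lambda>bs. ?H (bs @ as)) a"
    if a: "a \<noteq> []" "[] \<notin> set as" for a as
  proof -
    have "?H (a # as) = ?H [a] * ?H as" using mult[of "[a]" as] a by simp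
    also have "\<dots> = left_sum (cumulant ?H) ?H a * ?H as"
      by (simp add: left_sum_cumulant[where H = ?H, OF a(1) one])
    also have "\<dots> = left_sum (cumulant ?H) (\<lambda>bs. ?H bs * ?H as) a"
      by (simp add: left_sum_def sum_distrib_right mult.assoc)
    also have "\<dots> = left_sum (\<lambda>b. \<kappa> (bar_words s [b])) (\<lambda>bs. ?H (bs @ as)) a"
    proof (rule left_sum_cong)
      fix S assume "S \<subseteq> {..<length a}" "0 \<in> S"
      then have "nths a S \<noteq> []" by (intro nths_nonempty) auto
      then show "cumulant ?H (nths a S) * (?H (blocks a S) * ?H as) =
          \<kappa> (bar_words s [nths a S]) * ?H (blocks a S @ as)"
        using \<kappa>(2) mult[OF Nil_notin_blocks a(2)] by simp
    qed
    finally show ?thesis .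
  qed
  with one have "left_recursion s \<kappa> \<Phi>"
    by (simp add: left_recursion_def bar_words_Nil)
  with \<kappa>(1) show ?thesis by (rule that)
qed

section \<open>Characters and infinitesimal characters\<close>
theorem theorem7:
  fixes s :: "'k::field_char_0 \<Rightarrow> 'a::{ring, monoid_mult} \<Rightarrow> 'a"
  assumes "vector_space s"
    and "\<And>c x y. s c (x * y) = s c x * y"
    and "\<And>c x y. s c (x * y) = x * s c y"
  shows "(\<forall>\<Phi>\<in>characters s. \<exists>!\<kappa>. \<kappa> \<in> inf_characters s \<and>
            \<Phi> = (\<lambda>X\<in>TTbar s. aug s X + half_conv s \<kappa> \<Phi> X) \<and> \<Phi> = half_exp s \<kappa>) \<and>
         (\<forall>\<kappa>\<in>inf_characters s. half_exp s \<kappa> \<in> characters s) \<and>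
         bij_betw (half_exp s) (inf_characters s) (characters s)"
proof (intro conjI ballI)
  have exists: "\<exists>\<kappa>\<in>inf_characters s. left_recursion s \<kappa> \<Phi> \<and> \<Phi> = half_exp s \<kappa>"
    if \<Phi>: "\<Phi> \<in> characters s" for \<Phi>
  proof -
    obtain \<kappa> where \<kappa>: "\<kappa> \<in> inf_characters s" "left_recursion s \<kappa> \<Phi>"
      using \<Phi> by (rule character_left_recursion)
    moreover have "\<Phi> \<in> lin_forms s" using \<Phi> by (simp add: characters_def)
    ultimately show ?thesis using half_exp_unique_solution by blast
  qed
  show "\<exists>!\<kappa>. \<kappa> \<in> inf_characters s \<and>
      \<Phi> = (\<lambda>X\<in>TTbar s. aug s X + half_conv s \<kappa> \<Phi> X) \<and> \<Phi> = half_exp s \<kappa>"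
    if \<Phi>: "\<Phi> \<in> characters s" for \<Phi>
  proof -
    have "\<Phi> \<in> lin_forms s" using \<Phi> by (simp add: characters_def)
    note fixed_point = fixed_point_iff[OF _ this]
    obtain \<kappa> where \<kappa>: "\<kappa> \<in> inf_characters s" "left_recursion s \<kappa> \<Phi>" "\<Phi> = half_exp s \<kappa>"
      using exists[OF \<Phi>] by blast
    show ?thesis
    proof (rule ex1I[of _ \<kappa>])
      show "\<kappa> \<in> inf_characters s \<and>
          \<Phi> = (\<lambda>X\<in>TTbar s. aug s X + half_conv s \<kappa> \<Phi> X) \<and> \<Phi> = half_exp s \<kappa>"
        using \<kappa> fixed_point by blast
      fix \<kappa>' assume "\<kappa>' \<in> inf_characters s \<and>
          \<Phi> = (\<lambda>X\<in>TTbar s. aug s X + half_conv s \<kappa>' \<Phi> X) \<and> \<Phi> = half_exp s \<kappa>'"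
      then show "\<kappa>' = \<kappa>"
        using \<kappa> fixed_point left_recursion_determines by blast
    qed
  qed
  show "half_exp s \<kappa> \<in> characters s" if "\<kappa> \<in> inf_characters s" for \<kappa>
    using that by (rule half_exp_character)
  show "bij_betw (half_exp s) (inf_characters s) (characters s)"
    unfolding bij_betw_def
  proof
    show "inj_on (half_exp s) (inf_characters s)"
      by (rule inj_onI) (metis half_exp_left_recursion left_recursion_determines)
    show "half_exp s ` inf_characters s = characters s"
      using half_exp_character exists by blast
  qed
qed

end
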